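(* Let $x_0\in\mathbb{R}$ and write $a:=\overline{\mathrm D}_-\Phi(x_0)$, $b:=\underline{\mathrm D}_+\Phi(x_0)$. (i) If $a>b$, then $\mathcal{C}(x_0)=\varnothing$. (ii) If $a<b$, then $(a,b)\subset\mathcal{C}(x_0)\subset[a,b]$. Moreover: (a) $a\in\mathcal{C}(x_0)$ if and only if there is $t_1>0$ with $\Phi(l;x_0,a)>F(l;t_1,a)$ for small $l<0$; and $b\in\mathcal{C}(x_0)$ if and only if there is $t_2>0$ with $\Phi(l;x_0,b)>F(l;t_2,b)$ for small $l>0$. (b) If $f''(u)=(N_++o(1))|u-a|^{\alpha_+}$ as $u\to a+$ for some $\alpha_+\ge0$, $N_+>0$, then $a\in\mathcal{C}(x_0)$ if and only if $$\liminf_{l\to0-}|l|^{-\frac{2+\alpha_+}{1+\alpha_+}}\int_{x_0}^{x_0+l}(\varphi(\xi)-a)\,d\xi>-\infty.$$ If in addition $\varphi(x_0+l)-a=(C_{\gamma_-}+o(1))\,\mathrm{sgn}(l)|l|^{\gamma_-}$ as $l\to0-$ for some $\gamma_->0$, $C_{\gamma_-}\neq0$, then $a\in\mathcal{C}(x_0)$ if and only if $C_{\gamma_-}>0$ or $\gamma_-(1+\alpha_+)\ge1$. (c) If $f''(u)=(N_-+o(1))|u-b|^{\alpha_-}$ as $u\to b-$ for some $\alpha_-\ge0$, $N_->0$, then $b\in\mathcal{C}(x_0)$ if and only if $$\liminf_{l\to0+}|l|^{-\frac{2+\alpha_-}{1+\alpha_-}}\int_{x_0}^{x_0+l}(\varphi(\xi)-b)\,d\xi>-\infty.$$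 If in addition $\varphi(x_0+l)-b=(C_{\gamma_+}+o(1))\,\mathrm{sgn}(l)|l|^{\gamma_+}$ as $l\to0+$ for some $\gamma_+>0$, $C_{\gamma_+}\ne0$, then $b\in\mathcal{C}(x_0)$ if and only if $C_{\gamma_+}>0$ or $\gamma_+(1+\alpha_-)\ge1$. (iii) If $a=b$, then $\mathcal{C}(x_0)=\{a\}$ or $\mathcal{C}(x_0)=\varnothing$. Moreover: (a) $a\in\mathcal{C}(x_0)$ if and only if there is $t_1>0$ with $\Phi(l;x_0,a)>F(l;t_1,a)$ for small $l\neq0$. (b) If $f''(u)=(N_\pm+o(1))|u-a|^{\alpha_\pm}$ as $u\to a\pm$ for some $\alpha_\pm\ge0$, $N_\pm>0$, then $\mathcal{C}(x_0)=\varnothing$ if and only if at least one of the two limits $$\liminf_{l\to0\pm}|l|^{-\frac{2+\alpha_\mp}{1+\alpha_\mp}}\int_{x_0}^{x_0+l}(\varphi(\xi)-a)\,d\xi=-\infty$$ holds (upper signs together, or lower signs together). (c) If, in addition to the assumption in (iii)(b), $\varphi(x_0+l)-a=(C_{\gamma_\pm}+o(1))\,\mathrm{sgn}(l)|l|^{\gamma_\pm}$ as $l\to0\pm$ for some $\gamma_\pm>0$, $C_{\gamma_\pm}\ne0$, then $\mathcal{C}(x_0)=\varnothing$ if and only if at least one of the following two holds: $C_{\gamma_+}<0$ and $\gamma_+(1+\alpha_-)<1$; or $C_{\gamma_-}<0$ and $\gamma_-(1+\alpha_+)<1$.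
   Context: Setting: $f\in C^2(\mathbb{R})$, $f''\ge0$, $\mathcal{L}\{f''=0\}=0$ (Lebesgue measure), so $f'$ is strictly increasing; $\varphi\in L^\infty(\mathbb{R})$. For $t>0$: $E(u;x,t)=t\int_0^u f''(s)(\varphi(x-tf'(s))-s)\,ds$, and $\mathcal{U}(x,t)$ is the (nonempty compact) set of maximizers of $E(\cdot\,;x,t)$ over $\mathbb{R}$. For $x_0,c\in\mathbb{R}$ let $L_c(x_0)=\{(x,t): x=x_0+tf'(c),\ t>0\}$. The set of characteristic generation values of $x_0$ is $\mathcal{C}(x_0)=\{c\in\mathbb{R}: c\in\mathcal{U}(x,t)\text{ for some }(x,t)\in L_c(x_0)\}$. $\Phi(x)=\int_0^x\varphi(\xi)\,d\xi$; Dini derivatives: $\overline{\mathrm D}_-\Phi(x_0)=\limsup_{l\to0-}\frac1l\int_{x_0}^{x_0+l}\varphi\,d\xi$, $\underline{\mathrm D}_+\Phi(x_0)=\liminf_{l\to0+}\frac1l\int_{x_0}^{x_0+l}\varphi\,d\xi$. $\Phi(l;x_0,c)=\int_{x_0}^{x_0+l}(\varphi(\xi)-c)\,d\xi$ and $F(l;t,c)=-t\int_c^{u(l;t,c)}(s-c)f''(s)\,ds$, where $u(l;t,c)=(f')^{-1}(f'(c)-l/t)$ (defined for $l$ of the form $t(f'(c)-f'(u))$, in particular for all small $|l|$). "For small $l>0$" (resp. $l<0$, $l\ne0$) means for all such $l$ with $|l|<l_0$, for some $l_0>0$. Pointwise asymptotics of $\varphi$ are understood almost everywhere. *)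

theory Defs
  imports "HOL-Analysis.Analysis"
begin

text \<open>
  Throughout, \<open>f'\<close> and \<open>f''\<close> stand for the first and second derivative of the flux \<open>f\<close>.
  Integrals are oriented Lebesgue integrals with respect to the complete measure
  \<^term>\<open>lebesgue\<close>, because \<open>\<phi>\<close> is only Lebesgue measurable.
\<close>

definition E_fun ::
  "(real \<Rightarrow> real) \<Rightarrow> (real \<Rightarrow> real) \<Rightarrow> (real \<Rightarrow> real) \<Rightarrow> real \<Rightarrow> real \<Rightarrow> real \<Rightarrow> real" where
  "E_fun f' f'' \<phi> u x t =
     t * interval_lebesgue_integral lebesgue (ereal 0) (ereal u)
           (\<lambda>s. f'' s * (\<phi> (x - t * f' s) - s))"

definition maximizers ::
  "(real \<Rightarrow> real) \<Rightarrow> (real \<Rightarrow> real) \<Rightarrow> (real \<Rightarrow> real) \<Rightarrow> real \<Rightarrow> real \<Rightarrow> real set" where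
  "maximizers f' f'' \<phi> x t = {u. \<forall>v. E_fun f' f'' \<phi> v x t \<le> E_fun f' f'' \<phi> u x t}"

definition char_line :: "(real \<Rightarrow> real) \<Rightarrow> real \<Rightarrow> real \<Rightarrow> (real \<times> real) set" where
  "char_line f' c x0 = {(x, t). x = x0 + t * f' c \<and> t > 0}"

definition gen_values ::
  "(real \<Rightarrow> real) \<Rightarrow> (real \<Rightarrow> real) \<Rightarrow> (real \<Rightarrow> real) \<Rightarrow> real \<Rightarrow> real set" where
  "gen_values f' f'' \<phi> x0 =
     {c. \<exists>(x, t) \<in> char_line f' c x0. c \<in> maximizers f' f'' \<phi> x t}"

definition upper_left_dini :: "(real \<Rightarrow> real) \<Rightarrow> real \<Rightarrow> ereal" where
  "upper_left_dini \<phi> x0 =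
     Limsup (at_left 0)
       (\<lambda>l. ereal (1 / l * interval_lebesgue_integral lebesgue (ereal x0) (ereal (x0 + l)) \<phi>))"

definition lower_right_dini :: "(real \<Rightarrow> real) \<Rightarrow> real \<Rightarrow> ereal" where
  "lower_right_dini \<phi> x0 =
     Liminf (at_right 0)
       (\<lambda>l. ereal (1 / l * interval_lebesgue_integral lebesgue (ereal x0) (ereal (x0 + l)) \<phi>))"

definition Phi_fun :: "(real \<Rightarrow> real) \<Rightarrow> real \<Rightarrow> real \<Rightarrow> real \<Rightarrow> real" where
  "Phi_fun \<phi> l x0 c =
     interval_lebesgue_integral lebesgue (ereal x0) (ereal (x0 + l)) (\<lambda>\<xi>. \<phi> \<xi> - c)"

text \<open>
  Meaningful only when \<open>f' c - l / t\<close> lies in the range of the (injective) function \<open>f'\<close>,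
  in particular for all small \<open>l\<close>; elsewhere \<^term>\<open>inv\<close> is unspecified.
\<close>

definition u_fun :: "(real \<Rightarrow> real) \<Rightarrow> real \<Rightarrow> real \<Rightarrow> real \<Rightarrow> real" where
  "u_fun f' l t c = inv f' (f' c - l / t)"

definition F_fun ::
  "(real \<Rightarrow> real) \<Rightarrow> (real \<Rightarrow> real) \<Rightarrow> real \<Rightarrow> real \<Rightarrow> real \<Rightarrow> real" where
  "F_fun f' f'' l t c =
     - t * interval_lebesgue_integral lebesgue (ereal c) (ereal (u_fun f' l t c))
             (\<lambda>s. (s - c) * f'' s)"

text \<open>\<open>g u = (N + o(1)) |u - c|\<^sup>\<alpha>\<close> along the filter \<open>G\<close> (to be used with one-sided limits at \<open>c\<close>).\<close>

definition power_asymp ::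
  "(real \<Rightarrow> real) \<Rightarrow> real \<Rightarrow> real \<Rightarrow> real \<Rightarrow> real filter \<Rightarrow> bool" where
  "power_asymp g c N \<alpha> G \<longleftrightarrow>
     (\<exists>r. (r \<longlongrightarrow> 0) G \<and> (\<forall>\<^sub>F u in G. g u = (N + r u) * \<bar>u - c\<bar> powr \<alpha>))"

text \<open>
  \<open>\<psi> l = (C + o(1)) sgn l |l|\<^sup>\<gamma>\<close> as \<open>l \<rightarrow> 0\<close> within \<open>S\<close>, where the identity
  is only required for almost every \<open>l\<close>.
\<close>

definition ae_sgn_power_asymp ::
  "(real \<Rightarrow> real) \<Rightarrow> real \<Rightarrow> real \<Rightarrow> real set \<Rightarrow> bool" where
  "ae_sgn_power_asymp \<psi> C \<gamma> S \<longleftrightarrow>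
     (\<exists>r. (r \<longlongrightarrow> 0) (at 0 within S) \<and>
          (\<exists>\<delta>>0. AE l in lebesgue. l \<in> S \<and> \<bar>l\<bar> < \<delta> \<longrightarrow>
                    \<psi> l = (C + r l) * sgn l * \<bar>l\<bar> powr \<gamma>))"

text \<open>
  For essentially bounded \<open>\<phi>\<close> both Dini derivatives are finite, so that they may be
  converted to reals without loss.
\<close>

lemma mean_bound:
  assumes "\<phi> \<in> borel_measurable lebesgue" and M: "AE x in lebesgue. \<bar>\<phi> x\<bar> \<le> M"
  shows "\<bar>1 / l * interval_lebesgue_integral lebesgue (ereal x0) (ereal (x0 + l)) \<phi>\<bar> \<le> \<bar>M\<bar>"
proof -
  have main: "\<bar>set_lebesgue_integral lebesgue {p<..<q} \<phi>\<bar> \<le> \<bar>M\<bar> * (q - p)" if "p \<le> q" for p q :: real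
  proof -
    have int: "integrable lebesgue (\<lambda>x. indicator {p<..<q} x * \<bar>M\<bar>)"
      by (intro integrable_mult_left integrable_real_indicator) (use that in auto)
    have ae: "AE x in lebesgue. norm (indicator {p<..<q} x *\<^sub>R \<phi> x) \<le> indicator {p<..<q} x * \<bar>M\<bar>"
      using M by eventually_elim (auto simp: indicator_def)
    have int': "integrable lebesgue (\<lambda>x. indicator {p<..<q} x *\<^sub>R \<phi> x)"
    proof (rule Bochner_Integration.integrable_bound[OF int])
      show "(\<lambda>x. indicator {p<..<q} x *\<^sub>R \<phi> x) \<in> borel_measurable lebesgue"
        using assms(1) by (intro borel_measurable_scaleR borel_measurable_indicator) auto
      show "AE x in lebesgue. norm (indicator {p<..<q} x *\<^sub>R \<phi> x) \<le> norm (indicator {p<..<q} x * \<bar>M\<bar>)"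
        using ae by eventually_elim auto
    qed
    have "norm (set_lebesgue_integral lebesgue {p<..<q} \<phi>)
        \<le> integral\<^sup>L lebesgue (\<lambda>x. norm (indicator {p<..<q} x *\<^sub>R \<phi> x))"
      unfolding set_lebesgue_integral_def by (rule integral_norm_bound)
    also have "\<dots> \<le> integral\<^sup>L lebesgue (\<lambda>x. indicator {p<..<q} x * \<bar>M\<bar>)"
      by (intro integral_mono_AE integrable_norm int int' ae)
    also have "\<dots> = \<bar>M\<bar> * (q - p)"
      using that by simp
    finally show ?thesis by simp
  qed
  have "\<bar>interval_lebesgue_integral lebesgue (ereal x0) (ereal (x0 + l)) \<phi>\<bar> \<le> \<bar>M\<bar> * \<bar>l\<bar>"
    using main[of x0 "x0 + l"] main[of "x0 + l" x0]
    by (auto simp: interval_lebesgue_integral_def abs_if split: if_splits)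
  then show ?thesis
    by (cases "l = 0") (auto simp: abs_mult field_simps)
qed

lemma dini_finite:
  assumes "\<phi> \<in> borel_measurable lebesgue" and "AE x in lebesgue. \<bar>\<phi> x\<bar> \<le> M"
  shows "\<bar>upper_left_dini \<phi> x0\<bar> < \<infinity>" and "\<bar>lower_right_dini \<phi> x0\<bar> < \<infinity>"
proof -
  let ?m = "\<lambda>l. ereal (1 / l * interval_lebesgue_integral lebesgue (ereal x0) (ereal (x0 + l)) \<phi>)"
  have m: "ereal (- \<bar>M\<bar>) \<le> ?m l" "?m l \<le> ereal \<bar>M\<bar>" for l
    using mean_bound[OF assms, of l x0] unfolding ereal_less_eq by linarith+
  have "ereal (- \<bar>M\<bar>) \<le> upper_left_dini \<phi> x0 \<and> upper_left_dini \<phi> x0 \<le> ereal \<bar>M\<bar>"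
    unfolding upper_left_dini_def
    by (intro conjI Limsup_bounded le_Limsup always_eventually allI m) auto
  then show "\<bar>upper_left_dini \<phi> x0\<bar> < \<infinity>"
    by (cases "upper_left_dini \<phi> x0") auto
  have "ereal (- \<bar>M\<bar>) \<le> lower_right_dini \<phi> x0 \<and> lower_right_dini \<phi> x0 \<le> ereal \<bar>M\<bar>"
    unfolding lower_right_dini_def
    by (intro conjI Liminf_bounded Liminf_le always_eventually allI m) auto
  then show "\<bar>lower_right_dini \<phi> x0\<bar> < \<infinity>"
    by (cases "lower_right_dini \<phi> x0") auto
qed

end

theory Submission
  imports Defs
begin

text \<open>
  Substituting \<open>l = t (f' c - f' v)\<close> turns \<open>E(c) - E(v)\<close> on the line \<open>L\<^sub>c(x\<^sub>0)\<close> into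
  \<open>\<Phi>(l; x\<^sub>0, c) - F(l; t, c)\<close>, so that \<open>c\<close> is a generation value iff \<open>\<Phi> \<ge> F\<close> for some \<open>t\<close>.
  Here \<open>- F\<close> is \<open>t\<close> times a Bregman divergence of \<open>f\<close>. As a Legendre transform it strictly
  decreases in \<open>t\<close>, and for small \<open>t\<close> it exceeds any given multiple of \<open>|l|\<close> away from \<open>l = 0\<close>.
  As \<open>\<Phi>\<close> grows at most linearly, only the germs of \<open>\<Phi>\<close> and \<open>F\<close> at \<open>0-\<close> and \<open>0+\<close> matter,
  independently of each other. Since \<open>F = o(l)\<close>, the Dini derivatives decide every \<open>c\<close> but the
  end points; there, \<open>f'' \<sim> N |u - c|\<^sup>\<alpha>\<close> makes \<open>- F\<close> comparable to
  \<open>t\<^sup>1\<^sup>-\<^sup>\<beta> |l|\<^sup>\<beta>\<close> with \<open>\<beta> = (2 + \<alpha>) / (1 + \<alpha>)\<close>.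
\<close>

section \<open>Integrals and one-variable calculus\<close>

text \<open>For \<open>p > q\<close> the oriented integral is minus the one over the swapped
  interval, so ordered intervals suffice. \<open>H\<close> is a primitive only in the sense of
  integrals, as no derivative of it need exist when \<open>h\<close> is built from a merely
  measurable function.\<close>

lemma interval_lebesgue_integral_lebesgue_eq:
  fixes h H :: "real \<Rightarrow> real"
  assumes abs: "\<And>p q. p \<le> q \<Longrightarrow> h absolutely_integrable_on {p..q}"
    and int: "\<And>p q. p \<le> q \<Longrightarrow> (h has_integral (H q - H p)) {p..q}"
  shows "interval_lebesgue_integral lebesgue (ereal p) (ereal q) h = H q - H p"
proof -
  have "set_lebesgue_integral lebesgue {p<..<q} h = H q - H p" if "p \<le> q" for p q
  proof -
    have "h absolutely_integrable_on {p<..<q}"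
      using abs[OF that] by (rule set_integrable_subset) (auto intro: less_imp_le)
    then have "set_lebesgue_integral lebesgue {p<..<q} h = integral {p<..<q} h"
      by (rule set_lebesgue_integral_eq_integral)
    also have "\<dots> = H q - H p"
      using integral_unique[OF int[OF that]] integral_open_interval_real[of p q h] by simp
    finally show ?thesis .
  qed
  from this[of p q] this[of q p] show ?thesis
    by (simp add: interval_lebesgue_integral_def)
qed

lemma absolutely_integrable_AE_bounded:
  fixes \<phi> :: "real \<Rightarrow> real"
  assumes "\<phi> \<in> borel_measurable lebesgue" and M: "AE x in lebesgue. \<bar>\<phi> x\<bar> \<le> M"
  shows "\<phi> absolutely_integrable_on {p..q}"
  unfolding set_integrable_def
proof (rule Bochner_Integration.integrable_bound)
  show "integrable lebesgue (\<lambda>x. indicator {p..q} x * \<bar>M\<bar>)"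
    by (intro integrable_mult_left integrable_real_indicator) (auto simp: emeasure_lborel_Icc_eq)
  show "(\<lambda>x. indicator {p..q} x *\<^sub>R \<phi> x) \<in> borel_measurable lebesgue"
    using assms(1) by (intro borel_measurable_scaleR borel_measurable_indicator) auto
  show "AE x in lebesgue. norm (indicator {p..q} x *\<^sub>R \<phi> x) \<le> norm (indicator {p..q} x * \<bar>M\<bar>)"
    using M by eventually_elim (auto simp: indicator_def)
qed

lemma ex_indefinite_integral:
  fixes \<phi> :: "real \<Rightarrow> real"
  assumes "\<And>p q. \<phi> integrable_on {p..q}"
  obtains P where "\<And>p q. p \<le> q \<Longrightarrow> (\<phi> has_integral (P q - P p)) {p..q}"
proof
  define P where "P y = (if 0 \<le> y then integral {0..y} \<phi> else - integral {y..0} \<phi>)" for y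
  fix p q :: real
  assume "p \<le> q"
  have *: "integral {r..s} \<phi> + integral {s..u} \<phi> = integral {r..u} \<phi>" if "r \<le> s" "s \<le> u" for r s u
    using that assms by (rule Henstock_Kurzweil_Integration.integral_combine)
  have "P q - P p = integral {p..q} \<phi>"
    using *[of p 0 q] *[of 0 p q] *[of p q 0] \<open>p \<le> q\<close>
    by (auto simp: P_def)
  then show "(\<phi> has_integral (P q - P p)) {p..q}"
    using assms by (metis integrable_integral)
qed

lemma has_integral_subst_antimono:
  fixes \<phi> g g' P :: "real \<Rightarrow> real"
  assumes abs: "\<And>p q. \<phi> absolutely_integrable_on {p..q}"
    and P: "\<And>p q. p \<le> q \<Longrightarrow> (\<phi> has_integral (P q - P p)) {p..q}"
    and g: "\<And>s. (g has_real_derivative - g' s) (at s)" and g': "\<And>s. 0 \<le> g' s"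
    and mono: "\<And>r s. r < s \<Longrightarrow> g s < g r" and "p \<le> q"
  shows "(\<lambda>s. g' s * \<phi> (g s)) absolutely_integrable_on {p..q}"
    and "((\<lambda>s. g' s * \<phi> (g s)) has_integral (P (g p) - P (g q))) {p..q}"
proof -
  have le: "g q \<le> g p"
    using mono[of p q] \<open>p \<le> q\<close> by (cases "p = q") auto
  have inj: "inj_on g {p..q}"
    by (rule inj_onI) (metis mono less_irrefl linorder_neqE)
  have image: "g ` {p..q} = {g q..g p}"
  proof
    show "g ` {p..q} \<subseteq> {g q..g p}"
      using mono by (force simp: le_less)
    show "{g q..g p} \<subseteq> g ` {p..q}"
    proof
      fix y assume "y \<in> {g q..g p}"
      then obtain s where "p \<le> s" "s \<le> q" "g s = y"
        using IVT2[of g q y p] DERIV_isCont[OF g] \<open>p \<le> q\<close> by auto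
      then show "y \<in> g ` {p..q}" by auto
    qed
  qed
  have "\<phi> absolutely_integrable_on g ` {p..q} \<and> integral (g ` {p..q}) \<phi> = P (g p) - P (g q)"
    using abs P[OF le] by (auto simp: image integral_unique)
  then have *: "(\<lambda>s. \<bar>- g' s\<bar> * \<phi> (g s)) absolutely_integrable_on {p..q} \<and>
      integral {p..q} (\<lambda>s. \<bar>- g' s\<bar> * \<phi> (g s)) = P (g p) - P (g q)"
    by (subst has_absolute_integral_change_of_variables_1'[where g' = "\<lambda>s. - g' s"])
      (auto intro: has_field_derivative_at_within g inj)
  then show abs': "(\<lambda>s. g' s * \<phi> (g s)) absolutely_integrable_on {p..q}"
    using g' by simp
  show "((\<lambda>s. g' s * \<phi> (g s)) has_integral (P (g p) - P (g q))) {p..q}"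
    using * set_lebesgue_integral_eq_integral(1)[OF abs'] g' by (simp add: has_integral_iff)
qed

text \<open>If a nondecreasing \<open>g\<close> took the same value at \<open>x < y\<close>, it
  would be constant in between, and \<open>g'\<close> would vanish on an interval of positive
  measure.\<close>

lemma strict_mono_if_deriv_pos_AE:
  fixes g g' :: "real \<Rightarrow> real"
  assumes g: "\<And>u. (g has_real_derivative g' u) (at u)" and g': "\<And>u. 0 \<le> g' u"
    and null: "{u. g' u = 0} \<in> null_sets lebesgue"
  shows "strict_mono g"
proof
  fix x y :: real
  assume "x < y"
  have mono: "g u \<le> g v" if "u \<le> v" for u v
    using that g g' by (meson DERIV_nonneg_imp_nondecreasing)
  have "g x \<noteq> g y"
  proof
    assume eq: "g x = g y"
    have "g' u = 0" if "u \<in> {x<..<y}" for u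
    proof -
      have "g v = g x" if "v \<in> {x<..<y}" for v
        using mono[of x v] mono[of v y] eq that by auto
      then have "((\<lambda>_. g x) has_real_derivative g' u) (at u)"
        using g[of u] that by (rule_tac has_field_derivative_transform_within_open[of g _ _ "{x<..<y}"]) auto
      then show ?thesis
        by (metis DERIV_const DERIV_unique)
    qed
    then have "{x<..<y} \<subseteq> {u. g' u = 0}" by auto
    then have "emeasure lebesgue {x<..<y} \<le> emeasure lebesgue {u. g' u = 0}"
      using null by (intro emeasure_mono) auto
    then show False
      using null \<open>x < y\<close> by (auto simp: null_sets_def)
  qed
  then show "g x < g y"
    using mono[of x y] \<open>x < y\<close> by auto
qed

text \<open>Replacing \<open>g\<close> by \<open>h\<close> on the exceptional null set keeps the
  integral and makes the comparison hold at every point. The open interval matches one-sided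
  asymptotics, which say nothing at the base point itself.\<close>

lemma has_integral_le_AE:
  fixes g h :: "real \<Rightarrow> real"
  assumes g: "(g has_integral i) {p..q}" and h: "(h has_integral j) {p..q}"
    and le: "AE x in lebesgue. x \<in> {p<..<q} \<longrightarrow> g x \<le> h x"
  shows "i \<le> j"
proof -
  obtain N where N: "negligible N" "{x. \<not> (x \<in> {p<..<q} \<longrightarrow> g x \<le> h x)} \<subseteq> N"
    using le unfolding eventually_ae_filter negligible_iff_null_sets by auto
  have "((\<lambda>x. if x \<in> N then h x else g x) has_integral i) {p<..<q}"
    by (rule has_integral_spike[OF N(1) _ g[unfolded has_integral_Icc_iff_Ioo]]) simp
  then show ?thesis
    by (rule has_integral_le[OF _ h[unfolded has_integral_Icc_iff_Ioo]]) (use N(2) in auto)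
qed

lemma AE_lebesgue_translation:
  fixes c :: real
  assumes "AE l in lebesgue. P l"
  shows "AE x in lebesgue. P (x - c)"
proof -
  obtain N where N: "negligible N" "{x. \<not> P x} \<subseteq> N"
    using assms unfolding eventually_ae_filter negligible_iff_null_sets by auto
  have "(+) c ` N \<in> null_sets lebesgue"
    using negligible_translation[OF N(1)] by (simp add: negligible_iff_null_sets)
  then show ?thesis
  proof (rule AE_I')
    show "{x \<in> space lebesgue. \<not> P (x - c)} \<subseteq> (+) c ` N"
      using N(2) by (force simp: image_iff)
  qed
qed

section \<open>Comparison with powers\<close>

lemma deriv_le_powr_imp_le:
  fixes h h' :: "real \<Rightarrow> real"
  assumes deriv: "\<And>s. (h has_real_derivative h' s) (at s)"
    and le: "\<And>s. c < s \<Longrightarrow> s < v \<Longrightarrow> h' s \<le> m * (s - c) powr \<gamma>"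
    and "c \<le> v" "\<gamma> \<ge> 0"
  shows "h v - h c \<le> m / (1 + \<gamma>) * (v - c) powr (1 + \<gamma>)"
proof -
  let ?k = "\<lambda>s. m / (1 + \<gamma>) * (s - c) powr (1 + \<gamma>) - h s"
  have "?k c \<le> ?k v"
  proof (rule DERIV_nonneg_imp_increasing_open[OF \<open>c \<le> v\<close>])
    fix s assume s: "c < s" "s < v"
    have "(?k has_real_derivative (m * (s - c) powr \<gamma> - h' s)) (at s)"
      using s \<open>\<gamma> \<ge> 0\<close> by (auto intro!: derivative_eq_intros deriv)
    then show "\<exists>y. (?k has_real_derivative y) (at s) \<and> 0 \<le> y"
      using le[OF s] by (intro exI conjI) auto
  next
    \<comment> \<open>At \<open>c\<close> the power is only known to be continuous; the derivative
      is taken on the open interval, where \<open>s - c > 0\<close>.\<close>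
    show "continuous_on {c..v} ?k"
    proof (intro continuous_on_diff continuous_on_mult continuous_on_const)
      show "continuous_on {c..v} (\<lambda>s. (s - c) powr (1 + \<gamma>))"
        using \<open>\<gamma> \<ge> 0\<close> by (intro continuous_on_powr') (auto intro!: continuous_intros)
      show "continuous_on {c..v} h"
        using DERIV_isCont[OF deriv] by (simp add: continuous_at_imp_continuous_on)
    qed
  qed
  then show ?thesis by simp
qed

lemma deriv_ge_powr_imp_ge:
  fixes h h' :: "real \<Rightarrow> real"
  assumes "\<And>s. (h has_real_derivative h' s) (at s)"
    and "\<And>s. c < s \<Longrightarrow> s < v \<Longrightarrow> m * (s - c) powr \<gamma> \<le> h' s"
    and "c \<le> v" "\<gamma> \<ge> 0"
  shows "m / (1 + \<gamma>) * (v - c) powr (1 + \<gamma>) \<le> h v - h c"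
proof -
  have "- h v - - h c \<le> - m / (1 + \<gamma>) * (v - c) powr (1 + \<gamma>)"
    by (rule deriv_le_powr_imp_le[where h' = "\<lambda>s. - h' s"]) (use assms in \<open>auto intro: DERIV_minus\<close>)
  then show ?thesis by simp
qed

text \<open>Off \<open>0\<close> the sign is locally constant, so \<open>\<bar>y\<bar>\<close> may
  be replaced by the linear function \<open>sgn x * y\<close>; at \<open>0\<close> the difference
  quotient is of order \<open>\<bar>y\<bar> powr \<gamma>\<close> and tends to 0. Differentiability
  at \<open>0\<close> too lets the fundamental theorem be applied on intervals that end at the base
  point.\<close>

lemma has_real_derivative_abs_powr:
  assumes "\<gamma> > 0"
  shows "((\<lambda>x. \<bar>x\<bar> powr (1 + \<gamma>) / (1 + \<gamma>)) has_real_derivative sgn x * \<bar>x\<bar> powr \<gamma>) (at x)"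
proof (cases "x = 0")
  case False
  have "((\<lambda>y. (sgn x * y) powr (1 + \<gamma>) / (1 + \<gamma>)) has_real_derivative sgn x * \<bar>x\<bar> powr \<gamma>) (at x)"
    using False assms
    by (auto intro!: derivative_eq_intros simp: abs_sgn sgn_if)
  then show ?thesis
  proof (rule has_field_derivative_transform_within_open[where S = "{y. sgn y = sgn x}"])
    have "{y. sgn y = sgn x} = (if x > 0 then {0<..} else {..<0})"
      using False by (auto simp: sgn_if)
    then show "open {y. sgn y = sgn x}" by simp
    show "(sgn x * y) powr (1 + \<gamma>) / (1 + \<gamma>) = \<bar>y\<bar> powr (1 + \<gamma>) / (1 + \<gamma>)"
      if "y \<in> {y. sgn y = sgn x}" for y
      using that by (metis abs_sgn mem_Collect_eq mult.commute)
  qed auto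
next
  case True
  have "((\<lambda>y. \<bar>y\<bar> powr \<gamma>) \<longlongrightarrow> 0) (at (0::real))"
    using assms by (intro tendsto_zero_powrI[where b = \<gamma>] tendsto_rabs_zero tendsto_ident_at) auto
  then have "((\<lambda>y. sgn y * \<bar>y\<bar> powr \<gamma> / (1 + \<gamma>)) \<longlongrightarrow> 0) (at (0::real))"
    using assms
    by (intro Lim_null_comparison[of "\<lambda>y. sgn y * \<bar>y\<bar> powr \<gamma> / (1 + \<gamma>)" "\<lambda>y. \<bar>y\<bar> powr \<gamma>"] always_eventually)
      (auto simp: abs_mult sgn_if field_simps)
  moreover have "\<bar>y\<bar> powr (1 + \<gamma>) / (1 + \<gamma>) / y = sgn y * \<bar>y\<bar> powr \<gamma> / (1 + \<gamma>)" for y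
    by (cases "y = 0") (auto simp: powr_add sgn_if)
  ultimately show ?thesis
    using True by (simp add: has_field_derivative_iff)
qed

text \<open>The quantity equals a factor tending to \<open>C\<close> times
  \<open>\<bar>l\<bar> powr (\<rho> - \<beta>)\<close>. For \<open>C > 0\<close> it is eventually
  nonnegative, for \<open>\<beta> \<le> \<rho>\<close> it is bounded below because the power is at
  most 1, and in the remaining case it tends to minus infinity. The filter has to be nontrivial for
  the last case, since the lower limit along \<open>bot\<close> is plus infinity.\<close>

lemma powr_tendsto_imp_Liminf_gt_iff:
  fixes p :: "real \<Rightarrow> real"
  assumes lim: "((\<lambda>l. \<bar>l\<bar> powr (- \<rho>) * p l) \<longlongrightarrow> C) (at 0 within S)"
    and "C \<noteq> 0" and nontriv: "at 0 within S \<noteq> bot"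
  shows "Liminf (at 0 within S) (\<lambda>l. ereal (\<bar>l\<bar> powr (- \<beta>) * p l)) > - \<infinity> \<longleftrightarrow> C > 0 \<or> \<beta> \<le> \<rho>"
    (is "?Liminf > _ \<longleftrightarrow> _")
proof -
  let ?X = "\<lambda>l. \<bar>l\<bar> powr (- \<rho>) * p l"
  have nz: "\<forall>\<^sub>F l in at 0 within S. l \<noteq> (0::real)"
    by (auto simp: eventually_at_filter)
  have eq: "\<bar>l\<bar> powr (- \<beta>) * p l = ?X l * \<bar>l\<bar> powr (\<rho> - \<beta>)" if "l \<noteq> 0" for l
    using that by (simp add: powr_diff powr_minus field_simps)
  have to0: "((\<lambda>l. \<bar>l\<bar>) \<longlongrightarrow> 0) (at (0::real) within S)"
    by (intro tendsto_rabs_zero tendsto_ident_at)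
  have bdd: "?Liminf > - \<infinity>" if "\<forall>\<^sub>F l in at 0 within S. B \<le> \<bar>l\<bar> powr (- \<beta>) * p l" for B
  proof -
    have "ereal B \<le> ?Liminf"
      using that by (intro Liminf_bounded) simp
    then show ?thesis by (cases ?Liminf) auto
  qed
  consider "C > 0" | "\<beta> \<le> \<rho>" | "C < 0" "\<rho> < \<beta>"
    using \<open>C \<noteq> 0\<close> by linarith
  then show ?thesis
  proof cases
    case 1
    then have "\<forall>\<^sub>F l in at 0 within S. 0 < ?X l"
      by (rule order_tendstoD(1)[OF lim])
    with nz have "\<forall>\<^sub>F l in at 0 within S. 0 \<le> \<bar>l\<bar> powr (- \<beta>) * p l"
      by eventually_elim (simp add: eq)
    with 1 show ?thesis using bdd by auto
  next
    case 2
    have "\<forall>\<^sub>F l in at 0 within S. C - 1 < ?X l"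
      by (rule order_tendstoD(1)[OF lim]) simp
    moreover have "\<forall>\<^sub>F l in at 0 within S. \<bar>l\<bar> < (1::real)"
      by (rule order_tendstoD(2)[OF to0]) simp
    ultimately have "\<forall>\<^sub>F l in at 0 within S. - (\<bar>C\<bar> + 1) \<le> \<bar>l\<bar> powr (- \<beta>) * p l"
      using nz
    proof eventually_elim
      case (elim l)
      have "\<bar>l\<bar> powr (\<rho> - \<beta>) \<le> 1"
        using elim 2 by (intro powr_le1) auto
      have "- (\<bar>C\<bar> + 1) \<le> - (\<bar>C\<bar> + 1) * \<bar>l\<bar> powr (\<rho> - \<beta>)"
        using mult_left_mono[OF \<open>\<bar>l\<bar> powr (\<rho> - \<beta>) \<le> 1\<close>, of "\<bar>C\<bar> + 1"]
        by (simp add: algebra_simps)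
      also have "\<dots> \<le> ?X l * \<bar>l\<bar> powr (\<rho> - \<beta>)"
        using elim by (intro mult_right_mono) auto
      finally show ?case using elim by (simp add: eq)
    qed
    with 2 show ?thesis using bdd by auto
  next
    case 3
    have "((\<lambda>l. \<bar>l\<bar> powr (\<beta> - \<rho>)) \<longlongrightarrow> 0) (at 0 within S)"
      using 3 to0 by (intro tendsto_zero_powrI[where b = "\<beta> - \<rho>"]) auto
    then have "filterlim (\<lambda>l. inverse (\<bar>l\<bar> powr (\<beta> - \<rho>))) at_top (at 0 within S)"
      by (rule filterlim_inverse_at_top) (use nz in \<open>auto elim: eventually_mono\<close>)
    then have "filterlim (\<lambda>l. ?X l * inverse (\<bar>l\<bar> powr (\<beta> - \<rho>))) at_bot (at 0 within S)"
      using 3 by (intro filterlim_tendsto_neg_mult_at_bot[OF lim])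
    then have "\<forall>\<^sub>F l in at 0 within S. ?X l * inverse (\<bar>l\<bar> powr (\<beta> - \<rho>)) \<le> B" for B
      by (auto simp: filterlim_at_bot)
    then have *: "\<forall>\<^sub>F l in at 0 within S. ?X l * \<bar>l\<bar> powr (\<rho> - \<beta>) \<le> B" for B
      by (simp flip: powr_minus)
    have "\<forall>\<^sub>F l in at 0 within S. ereal (\<bar>l\<bar> powr (- \<beta>) * p l) \<le> ereal B" for B
      using eventually_conj[OF nz *[of B]] by (rule eventually_mono) (simp add: eq)
    then have "?Liminf \<le> ereal B" for B
      using nontriv by (intro Liminf_le)
    then have "?Liminf = - \<infinity>"
      by (rule ereal_bot)
    with 3 show ?thesis by auto
  qed
qed

section \<open>The Bregman divergence of a strictly convex flux\<close>

locale convex_flux =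
  fixes f f' f'' :: "real \<Rightarrow> real"
  assumes deriv_f: "\<And>u. (f has_real_derivative f' u) (at u)"
    and deriv_f': "\<And>u. (f' has_real_derivative f'' u) (at u)"
    and mono_f': "strict_mono f'"
begin

text \<open>The Bregman divergence of \<open>f\<close>, written as the value of \<open>\<integral> (s - c) f'' s ds\<close>
  from \<open>c\<close> to \<open>v\<close>.\<close>

definition gap :: "real \<Rightarrow> real \<Rightarrow> real" where
  "gap c v = (v - c) * f' v - f v + f c"

lemma tangent: "f v + f' v * (w - v) < f w" if "w \<noteq> v"
proof -
  consider "v < w" | "w < v" using \<open>w \<noteq> v\<close> by linarith
  then show ?thesis
  proof cases
    case 1
    then obtain z where z: "v < z" "f w - f v = (w - v) * f' z"
      using MVT2[of v w f f'] deriv_f by blast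
    then have "f' v * (w - v) < f' z * (w - v)"
      using 1 mono_f' by (simp add: strict_monoD)
    with z show ?thesis by (simp add: algebra_simps)
  next
    case 2
    then obtain z where z: "z < v" "f v - f w = (v - w) * f' z"
      using MVT2[of w v f f'] deriv_f by blast
    then have "f' z * (v - w) < f' v * (v - w)"
      using 2 mono_f' by (simp add: strict_monoD)
    with z show ?thesis by (simp add: algebra_simps)
  qed
qed

lemma tangent_le: "f v + f' v * (w - v) \<le> f w"
  using tangent[of w v] by (cases "w = v") auto

lemma gap_nonneg: "0 \<le> gap c v"
  using tangent_le[of v c] by (simp add: gap_def algebra_simps)

text \<open>This is the tangent inequality at \<open>c\<close>, whereas \<open>gap_nonneg\<close>
  uses the one at \<open>v\<close>. With l = t (f' c - f' v) it bounds \<open>t * gap c v\<close> by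
  |l| |c - v|, which is the source of F = o(l).\<close>

lemma gap_le: "gap c v \<le> (f' c - f' v) * (c - v)"
  using tangent_le[of c v] by (simp add: gap_def algebra_simps)

text \<open>With \<open>l = t (f' c - f' v)\<close> the right-hand side is a Legendre transform in \<open>l\<close>; equality
  holds for \<open>w = v\<close>.\<close>

lemma fenchel:
  assumes "t > 0"
  shows "- (t * (f' c - f' v)) * (w - c) - t * (f w - f c - f' c * (w - c)) \<le> t * gap c v"
proof -
  have "t * (f v + f' v * (w - v)) \<le> t * f w"
    using tangent_le assms by simp
  then show ?thesis by (simp add: gap_def algebra_simps)
qed

section \<open>The change of variables between \<open>l\<close> and \<open>v\<close>\<close>

lemma u_fun_eq: "u_fun f' (t * (f' c - f' v)) t c = v" if "t > 0"
  using that mono_f' by (simp add: u_fun_def strict_mono_imp_inj_on)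

text \<open>By continuity and strict monotonicity of \<open>f'\<close>, the map from
  \<open>v\<close> to \<open>l\<close> sends the \<open>e\<close>-neighbourhood of \<open>c\<close>
  onto a neighbourhood of \<open>0\<close>. Hence \<open>u_fun\<close> is a genuine inverse for
  small \<open>l\<close>, where the unspecified values of \<open>inv\<close> do not occur, and it
  tends to \<open>c\<close>.\<close>

lemma ex_u_near:
  assumes "t > 0" "e > 0"
  shows "\<forall>\<^sub>F l in nhds 0. \<exists>v. \<bar>v - c\<bar> < e \<and> l = t * (f' c - f' v)"
proof -
  have "f' c < f' (c + e)" "f' (c - e) < f' c"
    using mono_f' \<open>e > 0\<close> by (auto intro: strict_monoD)
  then have "\<forall>\<^sub>F l in nhds 0. l \<in> {t * (f' c - f' (c + e))<..<t * (f' c - f' (c - e))}"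
    using \<open>t > 0\<close> by (intro eventually_nhds_in_open) (auto simp: mult_less_0_iff)
  then show ?thesis
  proof eventually_elim
    case (elim l)
    then obtain v where v: "c - e \<le> v" "v \<le> c + e" "t * (f' c - f' v) = l"
      using IVT2[of "\<lambda>v. t * (f' c - f' v)" "c + e" l "c - e"] \<open>e > 0\<close> DERIV_isCont[OF deriv_f']
      by (auto intro!: continuous_intros)
    with elim have "v \<noteq> c - e" "v \<noteq> c + e" by auto
    with v show ?case by (intro exI[of _ v]) auto
  qed
qed

lemma u_fun_spec:
  assumes "t > 0"
  shows "\<forall>\<^sub>F l in nhds 0. t * (f' c - f' (u_fun f' l t c)) = l"
  using ex_u_near[OF assms zero_less_one, of c] by eventually_elim (use u_fun_eq assms in auto)

lemma tendsto_u_fun: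
  assumes "t > 0"
  shows "((\<lambda>l. u_fun f' l t c) \<longlongrightarrow> c) (nhds 0)"
proof (rule tendstoI)
  fix e :: real assume "e > 0"
  from ex_u_near[OF assms this, of c] show "\<forall>\<^sub>F l in nhds 0. dist (u_fun f' l t c) c < e"
    by eventually_elim (use u_fun_eq assms in \<open>auto simp: dist_real_def\<close>)
qed

text \<open>The sides are exchanged: \<open>l < 0\<close> means \<open>v > c\<close>. This is why
  the behaviour of \<open>\<Phi>\<close> on the left of \<open>x0\<close> is paired with that of
  \<open>f''\<close> on the right of \<open>c\<close>, and conversely.\<close>

lemma filterlim_u_fun:
  assumes "t > 0"
  shows "filterlim (\<lambda>l. u_fun f' l t c) (at_right c) (at_left 0)"
    and "filterlim (\<lambda>l. u_fun f' l t c) (at_left c) (at_right 0)"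
proof -
  have *: "\<forall>\<^sub>F l in at 0 within S. t * (f' c - f' (u_fun f' l t c)) = l"
    "((\<lambda>l. u_fun f' l t c) \<longlongrightarrow> c) (at 0 within S)" for S
    using u_fun_spec[OF assms, of c] tendsto_u_fun[OF assms, of c]
    by (auto intro: filter_leD[OF at_within_le_nhds] tendsto_mono[OF at_within_le_nhds])
  have less: "c < v \<longleftrightarrow> t * (f' c - f' v) < 0" "v < c \<longleftrightarrow> t * (f' c - f' v) > 0" for v
    using assms mono_f' by (auto simp: mult_less_0_iff zero_less_mult_iff strict_mono_less)
  have "\<forall>\<^sub>F l in at_left (0::real). l < 0" "\<forall>\<^sub>F l in at_right (0::real). l > 0"
    by (auto simp: eventually_at_filter)
  with *(1)[of "{..<0}"] *(1)[of "{0<..}"]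
  have "\<forall>\<^sub>F l in at_left 0. u_fun f' l t c \<in> {c<..}" "\<forall>\<^sub>F l in at_right 0. u_fun f' l t c \<in> {..<c}"
    by (auto simp: less elim: eventually_elim2)
  then show "filterlim (\<lambda>l. u_fun f' l t c) (at_right c) (at_left 0)"
    "filterlim (\<lambda>l. u_fun f' l t c) (at_left c) (at_right 0)"
    using *(2) by (auto simp: filterlim_at elim!: eventually_mono)
qed

text \<open>Near \<open>c\<close>, \<open>f''\<close> lies between N/2 and 2N times (s -
  c)^\<alpha>. Integrating once makes f' v - f' c comparable to (v - c)^(1+\<alpha>), and
  integrating (s - c) f'' s makes the divergence comparable to (v - c)^(2+\<alpha>). Eliminating v -
  c leaves the exponent (2+\<alpha>)/(1+\<alpha>).\<close>

lemma gap_asymp_right: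
  assumes "\<alpha> \<ge> 0" "N > 0" and asymp: "power_asymp f'' c N \<alpha> (at_right c)"
  obtains k1 k2 where "k1 > 0" "k2 > 0"
    "\<forall>\<^sub>F v in at_right c. k1 * \<bar>f' c - f' v\<bar> powr ((2 + \<alpha>) / (1 + \<alpha>)) \<le> gap c v \<and>
       gap c v \<le> k2 * \<bar>f' c - f' v\<bar> powr ((2 + \<alpha>) / (1 + \<alpha>))"
proof -
  define \<beta> where "\<beta> = (2 + \<alpha>) / (1 + \<alpha>)"
  have \<beta>: "\<beta> > 0" "(1 + \<alpha>) * \<beta> = 2 + \<alpha>"
    using \<open>\<alpha> \<ge> 0\<close> by (auto simp: \<beta>_def field_simps)
  define n1 n2 m1 m2 where "n1 = N / 2 / (1 + \<alpha>)" "n2 = 2 * N / (1 + \<alpha>)"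
    "m1 = N / 2 / (2 + \<alpha>)" "m2 = 2 * N / (2 + \<alpha>)"
  note nm = this
  have pos: "n1 > 0" "n2 > 0" "m1 > 0" "m2 > 0"
    using assms by (auto simp: nm)
  obtain r where r: "(r \<longlongrightarrow> 0) (at_right c)" "\<forall>\<^sub>F u in at_right c. f'' u = (N + r u) * \<bar>u - c\<bar> powr \<alpha>"
    using asymp by (auto simp: power_asymp_def)
  have "\<forall>\<^sub>F u in at_right c. - (N / 2) < r u" "\<forall>\<^sub>F u in at_right c. r u < N"
    using assms by (auto intro: order_tendstoD[OF r(1)])
  with r(2) have "\<forall>\<^sub>F u in at_right c. N / 2 * \<bar>u - c\<bar> powr \<alpha> \<le> f'' u \<and> f'' u \<le> 2 * N * \<bar>u - c\<bar> powr \<alpha>"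
  proof eventually_elim
    case (elim u)
    then show ?case
      unfolding elim(1) by (intro conjI mult_right_mono) auto
  qed
  then obtain d where d: "c < d"
    "\<And>s. c < s \<Longrightarrow> s < d \<Longrightarrow> N / 2 * (s - c) powr \<alpha> \<le> f'' s \<and> f'' s \<le> 2 * N * (s - c) powr \<alpha>"
    by (auto simp: eventually_at_right_field)
  have "m1 / n2 powr \<beta> * \<bar>f' c - f' v\<bar> powr \<beta> \<le> gap c v \<and> gap c v \<le> m2 / n1 powr \<beta> * \<bar>f' c - f' v\<bar> powr \<beta>"
    if v: "c < v" "v < d" for v
  proof -
    have f'_bounds: "n1 * (v - c) powr (1 + \<alpha>) \<le> f' v - f' c" "f' v - f' c \<le> n2 * (v - c) powr (1 + \<alpha>)"
      unfolding nm
      by (rule deriv_ge_powr_imp_ge[OF deriv_f'] deriv_le_powr_imp_le[OF deriv_f'];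
          use d(2) v \<open>\<alpha> \<ge> 0\<close> in force)+
    have gap': "(gap c has_real_derivative (s - c) * f'' s) (at s)" for s
      unfolding gap_def by (auto intro!: derivative_eq_intros deriv_f deriv_f')
    have gap_deriv: "N / 2 * (s - c) powr (1 + \<alpha>) \<le> (s - c) * f'' s"
      "(s - c) * f'' s \<le> 2 * N * (s - c) powr (1 + \<alpha>)" if "c < s" "s < v" for s
    proof -
      have "(s - c) powr (1 + \<alpha>) = (s - c) * (s - c) powr \<alpha>"
        using that by (simp add: powr_mult_base)
      then show "N / 2 * (s - c) powr (1 + \<alpha>) \<le> (s - c) * f'' s"
        "(s - c) * f'' s \<le> 2 * N * (s - c) powr (1 + \<alpha>)"
        using d(2)[of s] that v mult_left_mono[of _ _ "s - c"] by (auto simp: mult.left_commute)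
    qed
    have gap_bounds: "m1 * (v - c) powr (2 + \<alpha>) \<le> gap c v" "gap c v \<le> m2 * (v - c) powr (2 + \<alpha>)"
      using deriv_ge_powr_imp_ge[OF gap' gap_deriv(1)] deriv_le_powr_imp_le[OF gap' gap_deriv(2)]
        v \<open>\<alpha> \<ge> 0\<close> by (auto simp: nm gap_def)
    \<comment> \<open>In terms of \<open>y\<close> the increment of \<open>f'\<close> is comparable
      to \<open>y\<close> and the divergence to \<open>y powr \<beta>\<close>, so only monotonicity
      of the power \<open>\<beta>\<close> remains to be used.\<close>
    define y where "y = (v - c) powr (1 + \<alpha>)"
    define z where "z = f' v - f' c"
    have y: "(v - c) powr (2 + \<alpha>) = y powr \<beta>" "0 \<le> y"
      by (simp_all add: y_def powr_powr \<beta>)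
    have z: "\<bar>f' c - f' v\<bar> = z" "0 \<le> z" "n1 * y \<le> z" "z \<le> n2 * y"
      using strict_monoD[OF mono_f' v(1)] f'_bounds by (auto simp: z_def y_def)
    have "z powr \<beta> \<le> (n2 * y) powr \<beta>" "(n1 * y) powr \<beta> \<le> z powr \<beta>"
      using z y pos \<beta> by (auto intro!: powr_mono2)
    then have "z powr \<beta> / n2 powr \<beta> \<le> y powr \<beta>" "y powr \<beta> \<le> z powr \<beta> / n1 powr \<beta>"
      using pos y z by (auto simp: powr_mult field_simps)
    then have "m1 * (z powr \<beta> / n2 powr \<beta>) \<le> m1 * y powr \<beta>" "m2 * y powr \<beta> \<le> m2 * (z powr \<beta> / n1 powr \<beta>)"
      using pos by (intro mult_left_mono; simp)+
    with gap_bounds show ?thesis by (simp add: y(1) z(1))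
  qed
  then have "\<forall>\<^sub>F v in at_right c. m1 / n2 powr \<beta> * \<bar>f' c - f' v\<bar> powr \<beta> \<le> gap c v \<and>
      gap c v \<le> m2 / n1 powr \<beta> * \<bar>f' c - f' v\<bar> powr \<beta>"
    using d(1) by (auto simp: eventually_at_right_field)
  then show thesis
    using pos by (intro that[of "m1 / n2 powr \<beta>" "m2 / n1 powr \<beta>"]) (auto simp: \<beta>_def)
qed

text \<open>The reflection of \<open>u\<close> to \<open>- u\<close> yields another strictly convex
  flux, whose divergence from \<open>- c\<close> to \<open>v\<close> is that of \<open>f\<close>
  from \<open>c\<close> to \<open>- v\<close>; the right-sided case then applies.\<close>

lemma gap_asymp_left:
  assumes "\<alpha> \<ge> 0" "N > 0" and asymp: "power_asymp f'' c N \<alpha> (at_left c)"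
  obtains k1 k2 where "k1 > 0" "k2 > 0"
    "\<forall>\<^sub>F v in at_left c. k1 * \<bar>f' c - f' v\<bar> powr ((2 + \<alpha>) / (1 + \<alpha>)) \<le> gap c v \<and>
       gap c v \<le> k2 * \<bar>f' c - f' v\<bar> powr ((2 + \<alpha>) / (1 + \<alpha>))"
proof -
  interpret refl: convex_flux "\<lambda>u. f (- u)" "\<lambda>u. - f' (- u)" "\<lambda>u. f'' (- u)"
  proof
    have [derivative_intros]: "((\<lambda>u. h (- u)) has_real_derivative - h' (- u)) (at u)"
      if "\<And>u. (h has_real_derivative h' u) (at u)" for h h' :: "real \<Rightarrow> real" and u
    proof -
      have "((\<lambda>u. h (- u)) has_real_derivative h' (- u) * - 1) (at u)"
        by (rule DERIV_chain2[OF that]) (auto intro!: derivative_eq_intros)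
      then show ?thesis by simp
    qed
    show "((\<lambda>u. f (- u)) has_real_derivative - f' (- u)) (at u)"
      "((\<lambda>u. - f' (- u)) has_real_derivative f'' (- u)) (at u)" for u
      by (auto intro!: derivative_eq_intros deriv_f deriv_f')
    show "strict_mono (\<lambda>u. - f' (- u))"
      using mono_f' by (simp add: strict_mono_def)
  qed
  have "power_asymp (\<lambda>u. f'' (- u)) (- c) N \<alpha> (at_right (- c))"
  proof -
    obtain r where "(r \<longlongrightarrow> 0) (at_left c)" "\<forall>\<^sub>F u in at_left c. f'' u = (N + r u) * \<bar>u - c\<bar> powr \<alpha>"
      using asymp by (auto simp: power_asymp_def)
    then have "((\<lambda>u. r (- u)) \<longlongrightarrow> 0) (at_right (- c))"
      "\<forall>\<^sub>F u in at_right (- c). f'' (- u) = (N + r (- u)) * \<bar>- u - c\<bar> powr \<alpha>"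
      unfolding at_left_minus[of c] by (simp_all add: filterlim_filtermap eventually_filtermap)
    moreover have "\<bar>- u - c\<bar> = \<bar>u - - c\<bar>" for u by simp
    ultimately show ?thesis
      unfolding power_asymp_def by (intro exI[of _ "\<lambda>u. r (- u)"] conjI) simp_all
  qed
  from refl.gap_asymp_right[OF assms(1,2) this] obtain k1 k2 where k: "k1 > 0" "k2 > 0"
    "\<forall>\<^sub>F v in at_right (- c). k1 * \<bar>f' (- v) - f' c\<bar> powr ((2 + \<alpha>) / (1 + \<alpha>)) \<le> refl.gap (- c) v \<and>
       refl.gap (- c) v \<le> k2 * \<bar>f' (- v) - f' c\<bar> powr ((2 + \<alpha>) / (1 + \<alpha>))"
    by (auto simp: abs_minus_commute)
  have "refl.gap (- c) v = gap c (- v)" for v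
    by (simp add: refl.gap_def gap_def algebra_simps)
  with k(3) show thesis
    by (intro that[OF k(1,2)]) (simp add: at_left_minus[of c] eventually_filtermap abs_minus_commute)
qed

end

section \<open>Generation values\<close>

locale entropy_setting = convex_flux f f' f''
  for f f' f'' :: "real \<Rightarrow> real" +
  fixes \<phi> :: "real \<Rightarrow> real" and x0 M :: real
  assumes cont_f'': "continuous_on UNIV f''"
    and f''_nonneg: "\<And>u. 0 \<le> f'' u"
    and phi_meas: "\<phi> \<in> borel_measurable lebesgue"
    and phi_bdd: "AE x in lebesgue. \<bar>\<phi> x\<bar> \<le> M"
begin

section \<open>From E to \<open>\<Phi>\<close> and F\<close>

lemma abs_int_phi: "\<phi> absolutely_integrable_on {p..q}"
  using phi_meas phi_bdd by (rule absolutely_integrable_AE_bounded)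

lemma continuous_abs_int: "h absolutely_integrable_on {p..q}" if "continuous_on UNIV h" for h :: "real \<Rightarrow> real"
  using that by (intro absolutely_integrable_continuous_real) (auto intro: continuous_on_subset)

lemma ftc_moment:
  "p \<le> q \<Longrightarrow> ((\<lambda>s. (s - c) * f'' s) has_integral
     (((q - c) * f' q - f q) - ((p - c) * f' p - f p))) {p..q}"
  by (intro fundamental_theorem_of_calculus)
    (auto intro!: derivative_eq_intros deriv_f deriv_f'
      simp flip: has_real_derivative_iff_has_vector_derivative
      intro: has_field_derivative_at_within simp: algebra_simps)

lemma F_fun_eq: "F_fun f' f'' l t c = - t * gap c (u_fun f' l t c)"
proof -
  have "interval_lebesgue_integral lebesgue (ereal c) (ereal v) (\<lambda>s. (s - c) * f'' s)
      = ((v - c) * f' v - f v) - ((c - c) * f' c - f c)" for v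
    by (rule interval_lebesgue_integral_lebesgue_eq[OF _ ftc_moment])
      (auto intro!: continuous_abs_int continuous_intros cont_f'')
  then show ?thesis by (simp add: F_fun_def gap_def)
qed

lemma Phi_fun_eq:
  "Phi_fun \<phi> l x0 c = interval_lebesgue_integral lebesgue (ereal x0) (ereal (x0 + l)) \<phi> - c * l"
proof -
  obtain P where P: "\<And>p q. p \<le> q \<Longrightarrow> (\<phi> has_integral (P q - P p)) {p..q}"
    using ex_indefinite_integral abs_int_phi set_lebesgue_integral_eq_integral(1) by metis
  have "Phi_fun \<phi> l x0 c = (P (x0 + l) - c * (x0 + l)) - (P x0 - c * x0)"
    unfolding Phi_fun_def
  proof (rule interval_lebesgue_integral_lebesgue_eq)
    fix p q :: real assume "p \<le> q"
    show "(\<lambda>\<xi>. \<phi> \<xi> - c) absolutely_integrable_on {p..q}"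
      by (intro set_integral_diff abs_int_phi continuous_abs_int) auto
    show "((\<lambda>\<xi>. \<phi> \<xi> - c) has_integral P q - c * q - (P p - c * p)) {p..q}"
      using has_integral_diff[OF P[OF \<open>p \<le> q\<close>] has_integral_const_real[of c p q]] \<open>p \<le> q\<close>
      by (simp add: algebra_simps)
  qed
  moreover have "interval_lebesgue_integral lebesgue (ereal x0) (ereal (x0 + l)) \<phi> = P (x0 + l) - P x0"
    by (rule interval_lebesgue_integral_lebesgue_eq[OF abs_int_phi P])
  ultimately show ?thesis by (simp add: algebra_simps)
qed

lemma Phi_fun_bound: "\<bar>Phi_fun \<phi> l x0 c\<bar> \<le> (\<bar>M\<bar> + \<bar>c\<bar>) * \<bar>l\<bar>"
proof -
  let ?I = "interval_lebesgue_integral lebesgue (ereal x0) (ereal (x0 + l)) \<phi>"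
  have "\<bar>?I\<bar> \<le> \<bar>M\<bar> * \<bar>l\<bar>"
  proof (cases "l = 0")
    case False
    then show ?thesis
      using mean_bound[OF phi_meas phi_bdd, of l x0] by (simp add: abs_mult field_simps)
  qed (simp add: interval_lebesgue_integral_def set_lebesgue_integral_def)
  moreover have "\<bar>?I - c * l\<bar> \<le> \<bar>?I\<bar> + \<bar>c\<bar> * \<bar>l\<bar>"
    by (metis abs_mult abs_triangle_ineq4)
  ultimately show ?thesis
    by (simp add: Phi_fun_eq algebra_simps)
qed

text \<open>The map \<open>g\<close> sends \<open>c\<close> to \<open>x0\<close> and
  \<open>v\<close> to x0 + l with l = t (f' c - f' v), so the part of \<open>E_fun\<close>
  containing \<open>\<phi>\<close> becomes an integral of \<open>\<phi>\<close> from
  \<open>x0\<close> to x0 + l. The part containing s f'' s has the primitive s f' s - f s and,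
  together with the term c l, makes up \<open>t * gap c v\<close>.\<close>

lemma E_fun_diff:
  assumes "t > 0"
  shows "E_fun f' f'' \<phi> c (x0 + t * f' c) t - E_fun f' f'' \<phi> v (x0 + t * f' c) t
    = Phi_fun \<phi> (t * (f' c - f' v)) x0 c + t * gap c v"
proof -
  define g where "g s = x0 + t * f' c - t * f' s" for s
  obtain P where P: "\<And>p q. p \<le> q \<Longrightarrow> (\<phi> has_integral (P q - P p)) {p..q}"
    using ex_indefinite_integral abs_int_phi set_lebesgue_integral_eq_integral(1) by metis
  have g: "(g has_real_derivative - (t * f'' s)) (at s)" for s
    unfolding g_def by (auto intro!: derivative_eq_intros deriv_f')
  have g': "0 \<le> t * f'' s" for s
    using assms f''_nonneg by simp
  have g_mono: "g s < g r" if "r < s" for r s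
    using that assms mono_f' by (simp add: g_def strict_mono_less)
  have subst: "(\<lambda>s. t * f'' s * \<phi> (g s)) absolutely_integrable_on {p..q}"
    "((\<lambda>s. t * f'' s * \<phi> (g s)) has_integral (P (g p) - P (g q))) {p..q}" if "p \<le> q" for p q
    using has_integral_subst_antimono[of \<phi> P g "\<lambda>s. t * f'' s" p q] abs_int_phi P g g' g_mono that
    by blast+
  \<comment> \<open>The terms at \<open>0\<close> come from the lower limit of integration and
    cancel in the difference of two values of \<open>E_fun\<close>.\<close>
  have E: "E_fun f' f'' \<phi> u (x0 + t * f' c) t
      = (- P (g u) - t * (u * f' u - f u)) - (- P (g 0) - t * (0 * f' 0 - f 0))" for u
  proof -
    have "interval_lebesgue_integral lebesgue (ereal 0) (ereal u) (\<lambda>s. t * (f'' s * (\<phi> (g s) - s)))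
      = (- P (g u) - t * (u * f' u - f u)) - (- P (g 0) - t * (0 * f' 0 - f 0))"
    proof (rule interval_lebesgue_integral_lebesgue_eq)
      fix p q :: real assume "p \<le> q"
      have eq: "(\<lambda>s. t * (f'' s * (\<phi> (g s) - s))) = (\<lambda>s. t * f'' s * \<phi> (g s) - t * ((s - 0) * f'' s))"
        by (auto simp: algebra_simps)
      show "(\<lambda>s. t * (f'' s * (\<phi> (g s) - s))) absolutely_integrable_on {p..q}"
        unfolding eq
        by (intro set_integral_diff subst(1) \<open>p \<le> q\<close> continuous_abs_int continuous_intros cont_f'')
      show "((\<lambda>s. t * (f'' s * (\<phi> (g s) - s))) has_integral
          - P (g q) - t * (q * f' q - f q) - (- P (g p) - t * (p * f' p - f p))) {p..q}"
        unfolding eq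
        by (rule has_integral_eq_rhs[OF has_integral_diff[OF subst(2)[OF \<open>p \<le> q\<close>]
              has_integral_mult_right[OF ftc_moment[OF \<open>p \<le> q\<close>]]]]) (simp add: algebra_simps)
    qed
    then show ?thesis
      by (simp add: E_fun_def g_def)
  qed
  have "Phi_fun \<phi> (t * (f' c - f' v)) x0 c = P (g v) - P x0 - c * (t * (f' c - f' v))"
    by (simp add: Phi_fun_eq interval_lebesgue_integral_lebesgue_eq[OF abs_int_phi P] g_def algebra_simps)
  moreover have "g c = x0" by (simp add: g_def)
  ultimately show ?thesis
    by (simp add: E gap_def algebra_simps)
qed

section \<open>Generation values in terms of germs at l = 0\<close>

lemma gen_values_iff:
  "c \<in> gen_values f' f'' \<phi> x0 \<longleftrightarrow>
     (\<exists>t>0. \<forall>v. 0 \<le> Phi_fun \<phi> (t * (f' c - f' v)) x0 c + t * gap c v)"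
proof -
  have "c \<in> gen_values f' f'' \<phi> x0 \<longleftrightarrow>
     (\<exists>t>0. \<forall>v. 0 \<le> E_fun f' f'' \<phi> c (x0 + t * f' c) t - E_fun f' f'' \<phi> v (x0 + t * f' c) t)"
    by (auto simp: gen_values_def char_line_def maximizers_def)
  also have "\<dots> \<longleftrightarrow> (\<exists>t>0. \<forall>v. 0 \<le> Phi_fun \<phi> (t * (f' c - f' v)) x0 c + t * gap c v)"
    by (rule ex_cong) (auto simp: E_fun_diff)
  finally show ?thesis .
qed

text \<open>The point \<open>w\<close> that attains the Legendre transform for \<open>t\<close> is a
  competitor in the Fenchel inequality for \<open>t'\<close>. The subtracted term f w - f c - f' c
  (w - c) is positive because \<open>w \<noteq> c\<close>, so the smaller weight \<open>t'\<close>
  gives a strictly larger value.\<close>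

lemma F_fun_less:
  assumes "0 < t'" "t' < t"
  shows "\<forall>\<^sub>F l in at 0. F_fun f' f'' l t' c < F_fun f' f'' l t c"
proof -
  have "\<forall>\<^sub>F l in at 0. t * (f' c - f' (u_fun f' l t c)) = l"
    "\<forall>\<^sub>F l in at 0. t' * (f' c - f' (u_fun f' l t' c)) = l" "\<forall>\<^sub>F l in at 0. l \<noteq> (0::real)"
    using u_fun_spec[of t c] u_fun_spec[of t' c] assms
    by (auto simp: eventually_at_filter elim: eventually_mono)
  then show ?thesis
  proof eventually_elim
    case (elim l)
    define w where "w = u_fun f' l t c"
    define v where "v = u_fun f' l t' c"
    have w: "t * (f' c - f' w) = l" and v: "t' * (f' c - f' v) = l"
      using elim by (simp_all add: w_def v_def)
    have "w \<noteq> c" using w \<open>l \<noteq> 0\<close> by auto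
    then have D: "0 < f w - f c - f' c * (w - c)"
      using tangent[of w c] by (simp add: algebra_simps)
    have "t * gap c w = - l * (w - c) - t * (f w - f c - f' c * (w - c))"
      unfolding w[symmetric] by (simp add: gap_def algebra_simps)
    also have "\<dots> < - l * (w - c) - t' * (f w - f c - f' c * (w - c))"
      using D assms by simp
    also have "\<dots> \<le> t' * gap c v"
      using fenchel[of t' c v w] assms v by simp
    finally show ?case
      by (simp add: F_fun_eq w_def v_def)
  qed
qed

text \<open>Small \<open>t\<close> takes care of the \<open>l\<close> away from \<open>0\<close>: \<open>\<Phi>\<close> grows at most linearly, and the
  Fenchel inequality with \<open>w = c \<plusminus> (m + 1)\<close> makes \<open>- F\<close> grow with slope \<open>m + 1\<close>.\<close>

lemma gen_values_iff_eventually: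
  "c \<in> gen_values f' f'' \<phi> x0 \<longleftrightarrow>
     (\<exists>t>0. \<forall>\<^sub>F l in at 0. F_fun f' f'' l t c < Phi_fun \<phi> l x0 c)"
proof
  assume "c \<in> gen_values f' f'' \<phi> x0"
  then obtain t where t: "t > 0" "\<And>v. 0 \<le> Phi_fun \<phi> (t * (f' c - f' v)) x0 c + t * gap c v"
    unfolding gen_values_iff by blast
  have "\<forall>\<^sub>F l in at 0. t * (f' c - f' (u_fun f' l t c)) = l"
    using u_fun_spec[OF t(1), of c] by (rule filter_leD[OF at_within_le_nhds])
  \<comment> \<open>Maximality yields only the weak inequality at \<open>t\<close>; passing to
    \<open>t / 2\<close> makes it strict.\<close>
  moreover have "\<forall>\<^sub>F l in at 0. F_fun f' f'' l (t / 2) c < F_fun f' f'' l t c"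
    using t by (intro F_fun_less) auto
  ultimately have "\<forall>\<^sub>F l in at 0. F_fun f' f'' l (t / 2) c < Phi_fun \<phi> l x0 c"
  proof eventually_elim
    case (elim l)
    with t(2)[of "u_fun f' l t c"] show ?case by (simp add: F_fun_eq)
  qed
  with t(1) show "\<exists>t>0. \<forall>\<^sub>F l in at 0. F_fun f' f'' l t c < Phi_fun \<phi> l x0 c"
    by (intro exI[of _ "t / 2"]) auto
next
  assume "\<exists>t>0. \<forall>\<^sub>F l in at 0. F_fun f' f'' l t c < Phi_fun \<phi> l x0 c"
  then obtain t where t: "t > 0" and ev: "\<forall>\<^sub>F l in at 0. F_fun f' f'' l t c < Phi_fun \<phi> l x0 c"
    by blast
  then obtain d where d: "d > 0"
    "\<And>l. l \<noteq> 0 \<Longrightarrow> \<bar>l\<bar> < d \<Longrightarrow> F_fun f' f'' l t c < Phi_fun \<phi> l x0 c"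
    by (auto simp: eventually_at dist_real_def)
  have "\<forall>\<^sub>F l in nhds 0. t * (f' c - f' (u_fun f' l t c)) = l"
    using t by (rule u_fun_spec)
  then obtain d' where d': "d' > 0" "\<And>l. \<bar>l\<bar> < d' \<Longrightarrow> t * (f' c - f' (u_fun f' l t c)) = l"
    by (auto simp: eventually_nhds_metric dist_real_def)
  define m where "m = \<bar>M\<bar> + \<bar>c\<bar>"
  define D where "D w = f w - f c - f' c * (w - c)" for w
  have D: "0 \<le> D w" for w
    using tangent_le[of c w] by (simp add: D_def algebra_simps)
  define e where "e = min d d'"
  have "e > 0" using d d' by (simp add: e_def)
  \<comment> \<open>The time \<open>s\<close> is taken so small that the constant term
    \<open>s * D w\<close> stays below \<open>e\<close> for both competitors w = c \<plusminus> (m +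
    1); since \<open>D\<close> is nonnegative, the sum of the two values bounds each of
    them.\<close>
  have "\<forall>\<^sub>F s in at_right 0. s < t \<and> s * (D (c + (m + 1)) + D (c - (m + 1))) < e"
  proof (intro eventually_conj)
    show "\<forall>\<^sub>F s in at_right 0. s < t"
      using t by (rule order_tendstoD[OF tendsto_ident_at])
    have "((\<lambda>s. s * (D (c + (m + 1)) + D (c - (m + 1)))) \<longlongrightarrow> 0 * (D (c + (m + 1)) + D (c - (m + 1)))) (at_right 0)"
      by (intro tendsto_intros)
    then show "\<forall>\<^sub>F s in at_right 0. s * (D (c + (m + 1)) + D (c - (m + 1))) < e"
      using \<open>e > 0\<close> by (intro order_tendstoD) auto
  qed
  moreover have "\<forall>\<^sub>F s in at_right (0::real). s > 0"
    by (auto simp: eventually_at_filter)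
  ultimately have "\<forall>\<^sub>F s in at_right 0. s > 0 \<and> s < t \<and> s * (D (c + (m + 1)) + D (c - (m + 1))) < e"
    by eventually_elim auto
  then obtain s where s: "s > 0" "s < t" "s * (D (c + (m + 1)) + D (c - (m + 1))) < e"
    using eventually_happens' trivial_limit_at_right_real by (metis (mono_tags, lifting))
  have "0 \<le> Phi_fun \<phi> l x0 c + s * gap c v" if l: "l = s * (f' c - f' v)" for v l
  proof (cases "\<bar>l\<bar> < e")
    case True
    \<comment> \<open>For \<open>\<bar>l\<bar> < e\<close> the optimal point \<open>w\<close> for
      \<open>t\<close> competes at the smaller time \<open>s\<close>. Thus
      \<open>t * gap c w \<le> s * gap c v\<close>, and the assumed inequality at \<open>t\<close>
      carries over to \<open>s\<close>.\<close>
    define w where "w = u_fun f' l t c"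
    have w: "t * (f' c - f' w) = l"
      using True d'(2)[of l] by (simp add: w_def e_def)
    have "- l * (w - c) - s * D w \<le> s * gap c v"
      using fenchel[of s c v w] s l by (simp add: D_def)
    moreover have "t * gap c w = - l * (w - c) - t * D w"
      unfolding w[symmetric] D_def by (simp add: gap_def algebra_simps)
    moreover have "s * D w \<le> t * D w"
      using s D by (intro mult_right_mono) auto
    ultimately have "t * gap c w \<le> s * gap c v" by linarith
    moreover have "- (t * gap c w) \<le> Phi_fun \<phi> l x0 c"
    proof (cases "l = 0")
      case True
      then show ?thesis
        using Phi_fun_bound[of 0 c] gap_nonneg[of c w] t by simp
    next
      case False
      then show ?thesis
        using d(2)[of l] \<open>\<bar>l\<bar> < e\<close> by (simp add: F_fun_eq w_def e_def)
    qed
    ultimately show ?thesis by linarith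
  next
    case False
    \<comment> \<open>The sign makes \<open>- l * (w - c)\<close> equal to (m + 1) |l|. Then s gap
      is at least (m + 1) |l| - s D w > m |l| + (|l| - e), which suffices because now |l| \<ge> e
      and |\<open>\<Phi>\<close>| \<le> m |l|.\<close>
    define w where "w = c - sgn l * (m + 1)"
    have "- l * (w - c) = \<bar>l\<bar> * (m + 1)"
      by (simp add: w_def abs_sgn algebra_simps)
    moreover have "- l * (w - c) - s * D w \<le> s * gap c v"
      using fenchel[of s c v w] s l by (simp add: D_def)
    moreover have "s * D w < e"
    proof -
      have "w = c - (m + 1) \<or> w = c + (m + 1)"
        using False \<open>e > 0\<close> by (auto simp: w_def sgn_if)
      then have "D w \<le> D (c + (m + 1)) + D (c - (m + 1))"
        using D[of "c + (m + 1)"] D[of "c - (m + 1)"] by auto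
      then show ?thesis
        using s by (smt (verit) mult_left_mono)
    qed
    moreover have "\<bar>Phi_fun \<phi> l x0 c\<bar> \<le> m * \<bar>l\<bar>"
      using Phi_fun_bound by (simp add: m_def)
    ultimately show ?thesis
      using False by (simp add: algebra_simps)
  qed
  then show "c \<in> gen_values f' f'' \<phi> x0"
    unfolding gen_values_iff using s(1) by blast
qed

text \<open>The two sides may use different times: since F decreases when t does, a common smaller
  time serves both.\<close>

lemma gen_values_iff_sides:
  "c \<in> gen_values f' f'' \<phi> x0 \<longleftrightarrow>
     (\<exists>t>0. \<forall>\<^sub>F l in at_left 0. F_fun f' f'' l t c < Phi_fun \<phi> l x0 c) \<and>
     (\<exists>t>0. \<forall>\<^sub>F l in at_right 0. F_fun f' f'' l t c < Phi_fun \<phi> l x0 c)"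
    (is "_ \<longleftrightarrow> ?L \<and> ?R")
proof
  assume "c \<in> gen_values f' f'' \<phi> x0"
  then show "?L \<and> ?R"
    unfolding gen_values_iff_eventually eventually_at_split by blast
next
  assume "?L \<and> ?R"
  then obtain t1 t2 where t: "t1 > 0" "t2 > 0"
    and ev: "\<forall>\<^sub>F l in at_left 0. F_fun f' f'' l t1 c < Phi_fun \<phi> l x0 c"
      "\<forall>\<^sub>F l in at_right 0. F_fun f' f'' l t2 c < Phi_fun \<phi> l x0 c"
    by blast
  \<comment> \<open>Halving puts \<open>t\<close> strictly below both times, as
    \<open>F_fun_less\<close> requires.\<close>
  define t where "t = min t1 t2 / 2"
  have "\<forall>\<^sub>F l in at_left 0. F_fun f' f'' l t c < F_fun f' f'' l t1 c"
    "\<forall>\<^sub>F l in at_right 0. F_fun f' f'' l t c < F_fun f' f'' l t2 c"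
    using F_fun_less[of t t1 c] F_fun_less[of t t2 c] t
    by (auto simp: t_def eventually_at_split)
  with ev have "\<forall>\<^sub>F l in at_left 0. F_fun f' f'' l t c < Phi_fun \<phi> l x0 c"
    "\<forall>\<^sub>F l in at_right 0. F_fun f' f'' l t c < Phi_fun \<phi> l x0 c"
    by (auto elim: eventually_elim2)
  then show "c \<in> gen_values f' f'' \<phi> x0"
    unfolding gen_values_iff_eventually eventually_at_split
    using t by (intro exI[of _ t]) (auto simp: t_def)
qed

section \<open>Comparison with the Dini derivatives\<close>

lemma F_fun_over_tendsto:
  assumes "t > 0"
  shows "((\<lambda>l. F_fun f' f'' l t c / l) \<longlongrightarrow> 0) (at 0)"
proof (rule Lim_null_comparison)
  have "\<forall>\<^sub>F l in at 0. t * (f' c - f' (u_fun f' l t c)) = l"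
    using u_fun_spec[OF assms, of c] by (rule filter_leD[OF at_within_le_nhds])
  moreover have "\<forall>\<^sub>F l in at 0. l \<noteq> (0::real)"
    by (simp add: eventually_at_filter)
  ultimately show "\<forall>\<^sub>F l in at 0. norm (F_fun f' f'' l t c / l) \<le> \<bar>c - u_fun f' l t c\<bar>"
  proof eventually_elim
    case (elim l)
    let ?u = "u_fun f' l t c"
    have "\<bar>F_fun f' f'' l t c\<bar> = t * gap c ?u"
      using gap_nonneg assms by (simp add: F_fun_eq abs_mult)
    also have "\<dots> \<le> t * ((f' c - f' ?u) * (c - ?u))"
      using gap_le assms by simp
    also have "\<dots> = l * (c - ?u)"
      using elim(1) by (metis mult.assoc)
    also have "\<dots> \<le> \<bar>c - ?u\<bar> * \<bar>l\<bar>"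
      by (metis abs_ge_self abs_mult mult.commute)
    finally show ?case
      using elim by (simp add: field_simps)
  qed
  have "((\<lambda>l. u_fun f' l t c) \<longlongrightarrow> c) (at 0)"
    by (rule tendsto_mono[OF at_within_le_nhds tendsto_u_fun[OF assms]])
  then show "((\<lambda>l. \<bar>c - u_fun f' l t c\<bar>) \<longlongrightarrow> 0) (at 0)"
    by (intro tendsto_rabs_zero) (auto intro!: tendsto_eq_intros)
qed

lemma F_fun_nonpos: "t > 0 \<Longrightarrow> F_fun f' f'' l t c \<le> 0"
  using gap_nonneg by (simp add: F_fun_eq mult_nonneg_nonneg)

text \<open>The strict inequality makes \<open>\<Phi>\<close> positive for small
  \<open>l > 0\<close>, while F is never positive. Every time works, and 1 is taken.\<close>

lemma right_if_less:
  assumes "ereal c < lower_right_dini \<phi> x0"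
  shows "\<exists>t>0. \<forall>\<^sub>F l in at_right 0. F_fun f' f'' l t c < Phi_fun \<phi> l x0 c"
proof -
  have "\<forall>\<^sub>F l in at_right 0. ereal c < ereal (1 / l * interval_lebesgue_integral lebesgue (ereal x0) (ereal (x0 + l)) \<phi>)"
    using assms unfolding lower_right_dini_def by (rule less_LiminfD)
  moreover have "\<forall>\<^sub>F l in at_right 0. l > (0::real)"
    by (auto simp: eventually_at_filter)
  ultimately have "\<forall>\<^sub>F l in at_right 0. F_fun f' f'' l 1 c < Phi_fun \<phi> l x0 c"
  proof eventually_elim
    case (elim l)
    then show ?case
      using F_fun_nonpos[of 1 l c] by (auto simp: Phi_fun_eq field_simps)
  qed
  then show ?thesis by (intro exI[of _ 1]) auto
qed

text \<open>Again \<open>\<Phi>\<close> is positive near \<open>0\<close>, but division by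
  \<open>l < 0\<close> reverses inequalities. Hence the upper Dini derivative and the opposite
  comparison with \<open>c\<close> appear on the left.\<close>

lemma left_if_greater:
  assumes "upper_left_dini \<phi> x0 < ereal c"
  shows "\<exists>t>0. \<forall>\<^sub>F l in at_left 0. F_fun f' f'' l t c < Phi_fun \<phi> l x0 c"
proof -
  have "\<forall>\<^sub>F l in at_left 0. ereal (1 / l * interval_lebesgue_integral lebesgue (ereal x0) (ereal (x0 + l)) \<phi>) < ereal c"
    using assms unfolding upper_left_dini_def by (rule Limsup_lessD)
  moreover have "\<forall>\<^sub>F l in at_left 0. l < (0::real)"
    by (auto simp: eventually_at_filter)
  ultimately have "\<forall>\<^sub>F l in at_left 0. F_fun f' f'' l 1 c < Phi_fun \<phi> l x0 c"
  proof eventually_elim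
    case (elim l)
    then show ?case
      using F_fun_nonpos[of 1 l c] by (auto simp: Phi_fun_eq field_simps)
  qed
  then show ?thesis by (intro exI[of _ 1]) auto
qed

text \<open>Dividing \<open>\<Phi>\<close> > F by \<open>l > 0\<close> bounds the mean of
  \<open>\<phi>\<close> below by c + F/l, and F/l tends to 0. Only the weak inequality survives the
  limit, so equality has to be decided by finer asymptotics.\<close>

lemma right_imp_le:
  assumes "t > 0" "\<forall>\<^sub>F l in at_right 0. F_fun f' f'' l t c < Phi_fun \<phi> l x0 c"
  shows "ereal c \<le> lower_right_dini \<phi> x0"
proof (rule ereal_le_epsilon2)
  fix e :: real assume "e > 0"
  have "\<forall>\<^sub>F l in at_right 0. - e < F_fun f' f'' l t c / l"
    using \<open>e > 0\<close>
    by (intro order_tendstoD(1)[OF tendsto_mono[OF at_le F_fun_over_tendsto[OF assms(1)]]]) auto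
  moreover have "\<forall>\<^sub>F l in at_right 0. l > (0::real)"
    by (auto simp: eventually_at_filter)
  ultimately have "\<forall>\<^sub>F l in at_right 0. ereal (c - e) \<le> ereal (1 / l * interval_lebesgue_integral lebesgue (ereal x0) (ereal (x0 + l)) \<phi>)"
    using assms(2) by eventually_elim (auto simp: Phi_fun_eq field_simps)
  then have "ereal (c - e) \<le> lower_right_dini \<phi> x0"
    unfolding lower_right_dini_def by (rule Liminf_bounded)
  then show "ereal c \<le> lower_right_dini \<phi> x0 + ereal e"
    by (cases "lower_right_dini \<phi> x0") auto
qed

lemma left_imp_ge:
  assumes "t > 0" "\<forall>\<^sub>F l in at_left 0. F_fun f' f'' l t c < Phi_fun \<phi> l x0 c"
  shows "upper_left_dini \<phi> x0 \<le> ereal c"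
proof (rule ereal_le_epsilon2)
  fix e :: real assume "e > 0"
  have "\<forall>\<^sub>F l in at_left 0. F_fun f' f'' l t c / l < e"
    using \<open>e > 0\<close>
    by (intro order_tendstoD(2)[OF tendsto_mono[OF at_le F_fun_over_tendsto[OF assms(1)]]]) auto
  moreover have "\<forall>\<^sub>F l in at_left 0. l < (0::real)"
    by (auto simp: eventually_at_filter)
  ultimately have "\<forall>\<^sub>F l in at_left 0. ereal (1 / l * interval_lebesgue_integral lebesgue (ereal x0) (ereal (x0 + l)) \<phi>) \<le> ereal (c + e)"
    using assms(2) by eventually_elim (auto simp: Phi_fun_eq field_simps)
  then have "upper_left_dini \<phi> x0 \<le> ereal (c + e)"
    unfolding upper_left_dini_def by (rule Limsup_bounded)
  then show "upper_left_dini \<phi> x0 \<le> ereal c + ereal e"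
    by simp
qed

section \<open>Power laws at the end points\<close>

lemma one_sided_iff_Liminf:
  assumes "\<alpha> \<ge> 0" and k: "k1 > 0" "k2 > 0"
    and bounds: "\<forall>\<^sub>F v in H. k1 * \<bar>f' c - f' v\<bar> powr ((2 + \<alpha>) / (1 + \<alpha>)) \<le> gap c v \<and>
       gap c v \<le> k2 * \<bar>f' c - f' v\<bar> powr ((2 + \<alpha>) / (1 + \<alpha>))"
    and lim: "\<And>t. t > 0 \<Longrightarrow> filterlim (\<lambda>l. u_fun f' l t c) H (at 0 within S)"
  shows "(\<exists>t>0. \<forall>\<^sub>F l in at 0 within S. F_fun f' f'' l t c < Phi_fun \<phi> l x0 c) \<longleftrightarrow>
    Liminf (at 0 within S) (\<lambda>l. ereal (\<bar>l\<bar> powr (- ((2 + \<alpha>) / (1 + \<alpha>))) * Phi_fun \<phi> l x0 c)) > - \<infinity>"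
    (is "?L \<longleftrightarrow> ?Liminf > _")
proof -
  define \<beta> where "\<beta> = (2 + \<alpha>) / (1 + \<alpha>)"
  have "\<beta> > 1" using \<open>\<alpha> \<ge> 0\<close> by (simp add: \<beta>_def field_simps)
  \<comment> \<open>Since |f' c - f' u| = |l|/t, the bounds on t gap scale like t^(1-\<beta>)
    |l|^\<beta>. As \<beta> > 1, the coefficient t^(1-\<beta>) takes every positive value, so any
    finite lower bound for |l|^(-\<beta>) \<open>\<Phi>\<close> can be undercut by F at a suitable
    time.\<close>
  have F: "\<forall>\<^sub>F l in at 0 within S. l \<noteq> 0 \<and> - k2 * t powr (1 - \<beta>) * \<bar>l\<bar> powr \<beta> \<le> F_fun f' f'' l t c
      \<and> F_fun f' f'' l t c \<le> - k1 * t powr (1 - \<beta>) * \<bar>l\<bar> powr \<beta>" if t: "t > 0" for t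
  proof -
    have "\<forall>\<^sub>F l in at 0 within S. t * (f' c - f' (u_fun f' l t c)) = l"
      using u_fun_spec[OF t, of c] by (rule filter_leD[OF at_within_le_nhds])
    moreover have "\<forall>\<^sub>F l in at 0 within S. l \<noteq> (0::real)"
      by (auto simp: eventually_at_filter)
    ultimately show ?thesis
      using eventually_compose_filterlim[OF bounds lim[OF t]]
    proof eventually_elim
      case (elim l)
      have "f' c - f' (u_fun f' l t c) = l / t"
        using elim(1) t by (simp add: field_simps)
      then have "k1 * (\<bar>l\<bar> / t) powr \<beta> \<le> gap c (u_fun f' l t c)" "gap c (u_fun f' l t c) \<le> k2 * (\<bar>l\<bar> / t) powr \<beta>"
        using elim(3) t by (auto simp: \<beta>_def)
      then have "t * (k1 * (\<bar>l\<bar> / t) powr \<beta>) \<le> t * gap c (u_fun f' l t c)"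
        "t * gap c (u_fun f' l t c) \<le> t * (k2 * (\<bar>l\<bar> / t) powr \<beta>)"
        using t by (auto intro: mult_left_mono)
      moreover have "t * (k * (\<bar>l\<bar> / t) powr \<beta>) = k * t powr (1 - \<beta>) * \<bar>l\<bar> powr \<beta>" for k
        using t by (simp add: powr_divide powr_diff)
      ultimately show ?case
        using elim(2) by (simp add: F_fun_eq)
    qed
  qed
  have scale: "B < \<bar>l\<bar> powr (- \<beta>) * p \<longleftrightarrow> B * \<bar>l\<bar> powr \<beta> < p" if "l \<noteq> 0" for B l p :: real
    using that by (simp add: powr_minus field_simps)
  show ?thesis
  proof
    assume ?L
    then obtain t where t: "t > 0" "\<forall>\<^sub>F l in at 0 within S. F_fun f' f'' l t c < Phi_fun \<phi> l x0 c"
      by blast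
    from F[OF t(1)] t(2) have "\<forall>\<^sub>F l in at 0 within S. ereal (- k2 * t powr (1 - \<beta>)) \<le> ereal (\<bar>l\<bar> powr (- \<beta>) * Phi_fun \<phi> l x0 c)"
    proof eventually_elim
      case (elim l)
      then have "- k2 * t powr (1 - \<beta>) < \<bar>l\<bar> powr (- \<beta>) * Phi_fun \<phi> l x0 c"
        by (subst scale) auto
      then show ?case by simp
    qed
    then have "ereal (- k2 * t powr (1 - \<beta>)) \<le> ?Liminf"
      unfolding \<beta>_def[symmetric] by (rule Liminf_bounded)
    then show "?Liminf > - \<infinity>"
      by (cases ?Liminf) auto
  next
    assume "?Liminf > - \<infinity>"
    then obtain B where "ereal B < ?Liminf"
      using ereal_dense2 by blast
    then have ev: "\<forall>\<^sub>F l in at 0 within S. ereal B < ereal (\<bar>l\<bar> powr (- \<beta>) * Phi_fun \<phi> l x0 c)"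
      unfolding \<beta>_def[symmetric] by (rule less_LiminfD)
    \<comment> \<open>This solves k1 t^(1-\<beta>) = |B| + 1, so that F lies below -(|B| + 1)
      |l|^\<beta> and hence below B |l|^\<beta>.\<close>
    define t where "t = ((\<bar>B\<bar> + 1) / k1) powr (1 / (1 - \<beta>))"
    have t: "t > 0" "k1 * t powr (1 - \<beta>) = \<bar>B\<bar> + 1"
      using k \<open>\<beta> > 1\<close> by (auto simp: t_def powr_powr)
    from F[OF t(1)] ev have "\<forall>\<^sub>F l in at 0 within S. F_fun f' f'' l t c < Phi_fun \<phi> l x0 c"
    proof eventually_elim
      case (elim l)
      have "F_fun f' f'' l t c \<le> - (\<bar>B\<bar> + 1) * \<bar>l\<bar> powr \<beta>"
        using elim t(2) by simp
      also have "\<dots> \<le> B * \<bar>l\<bar> powr \<beta>"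
        by (intro mult_right_mono) auto
      also have "\<dots> < Phi_fun \<phi> l x0 c"
        using elim scale[of l B] by simp
      finally show ?case .
    qed
    with t(1) show ?L by blast
  qed
qed

lemma left_iff_Liminf:
  assumes "\<alpha> \<ge> 0" "N > 0" "power_asymp f'' c N \<alpha> (at_right c)"
  shows "(\<exists>t>0. \<forall>\<^sub>F l in at_left 0. F_fun f' f'' l t c < Phi_fun \<phi> l x0 c) \<longleftrightarrow>
    Liminf (at_left 0) (\<lambda>l. ereal (\<bar>l\<bar> powr (- ((2 + \<alpha>) / (1 + \<alpha>))) * Phi_fun \<phi> l x0 c)) > - \<infinity>"
  by (rule gap_asymp_right[OF assms]) (rule one_sided_iff_Liminf[OF assms(1) _ _ _ filterlim_u_fun(1)])

lemma right_iff_Liminf: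
  assumes "\<alpha> \<ge> 0" "N > 0" "power_asymp f'' c N \<alpha> (at_left c)"
  shows "(\<exists>t>0. \<forall>\<^sub>F l in at_right 0. F_fun f' f'' l t c < Phi_fun \<phi> l x0 c) \<longleftrightarrow>
    Liminf (at_right 0) (\<lambda>l. ereal (\<bar>l\<bar> powr (- ((2 + \<alpha>) / (1 + \<alpha>))) * Phi_fun \<phi> l x0 c)) > - \<infinity>"
  by (rule gap_asymp_left[OF assms]) (rule one_sided_iff_Liminf[OF assms(1) _ _ _ filterlim_u_fun(2)])

text \<open>Near \<open>x0\<close>, \<phi> - c is squeezed between C - \<epsilon> and C + \<epsilon>
  times the odd power of \<xi> - x0, in an order depending on the side, and the squeeze is
  integrated. The primitive |l|^(1+\<gamma>)/(1+\<gamma>) is even, so both sides give the same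
  formula for the limit.\<close>

lemma Phi_fun_asymp:
  assumes asymp: "ae_sgn_power_asymp (\<lambda>l. \<phi> (x0 + l) - c) C \<gamma> S"
    and "\<gamma> > 0" and S: "S = {..<0} \<or> S = {0<..}"
  shows "((\<lambda>l. \<bar>l\<bar> powr (- (1 + \<gamma>)) * Phi_fun \<phi> l x0 c) \<longlongrightarrow> C / (1 + \<gamma>)) (at 0 within S)"
proof (rule tendstoI)
  fix e :: real assume "e > 0"
  \<comment> \<open>With this choice the integrated error \<epsilon>/(1+\<gamma>) equals
    e/2.\<close>
  define \<epsilon> where "\<epsilon> = e * (1 + \<gamma>) / 2"
  have "\<epsilon> > 0" using \<open>e > 0\<close> \<open>\<gamma> > 0\<close> by (simp add: \<epsilon>_def)
  obtain r \<delta> where r: "(r \<longlongrightarrow> 0) (at 0 within S)" and "\<delta> > 0"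
    and ae: "AE l in lebesgue. l \<in> S \<and> \<bar>l\<bar> < \<delta> \<longrightarrow> \<phi> (x0 + l) - c = (C + r l) * sgn l * \<bar>l\<bar> powr \<gamma>"
    using asymp by (auto simp: ae_sgn_power_asymp_def)
  obtain \<eta> where "\<eta> > 0" and \<eta>: "\<And>l. l \<in> S \<Longrightarrow> l \<noteq> 0 \<Longrightarrow> \<bar>l\<bar> < \<eta> \<Longrightarrow> \<bar>r l\<bar> < \<epsilon>"
    using tendstoD[OF r \<open>\<epsilon> > 0\<close>] by (auto simp: eventually_at dist_real_def)
  define d where "d = min \<delta> \<eta>"
  have "d > 0" using \<open>\<delta> > 0\<close> \<open>\<eta> > 0\<close> by (simp add: d_def)
  have bound: "AE \<xi> in lebesgue. \<xi> - x0 \<in> S \<and> \<bar>\<xi> - x0\<bar> < d \<longrightarrow>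
      \<bar>\<phi> \<xi> - c - C * (sgn (\<xi> - x0) * \<bar>\<xi> - x0\<bar> powr \<gamma>)\<bar> \<le> \<epsilon> * \<bar>\<xi> - x0\<bar> powr \<gamma>"
    using AE_lebesgue_translation[OF ae, of x0]
  proof eventually_elim
    case (elim \<xi>)
    show ?case
    proof (intro impI)
      assume *: "\<xi> - x0 \<in> S \<and> \<bar>\<xi> - x0\<bar> < d"
      then have "\<phi> \<xi> - c - C * (sgn (\<xi> - x0) * \<bar>\<xi> - x0\<bar> powr \<gamma>)
          = r (\<xi> - x0) * sgn (\<xi> - x0) * \<bar>\<xi> - x0\<bar> powr \<gamma>"
        using elim by (simp add: d_def algebra_simps)
      also have "\<bar>\<dots>\<bar> = \<bar>r (\<xi> - x0)\<bar> * \<bar>\<xi> - x0\<bar> powr \<gamma>"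
        using * S by (auto simp: abs_mult sgn_if)
      also have "\<dots> \<le> \<epsilon> * \<bar>\<xi> - x0\<bar> powr \<gamma>"
        using * S \<eta>[of "\<xi> - x0"] by (intro mult_right_mono) (auto simp: d_def)
      finally show "\<bar>\<phi> \<xi> - c - C * (sgn (\<xi> - x0) * \<bar>\<xi> - x0\<bar> powr \<gamma>)\<bar> \<le> \<epsilon> * \<bar>\<xi> - x0\<bar> powr \<gamma>" .
    qed
  qed
  define H where "H D \<xi> = c * \<xi> + D * (\<bar>\<xi> - x0\<bar> powr (1 + \<gamma>) / (1 + \<gamma>))" for D \<xi>
  define h where "h D \<xi> = c + D * (sgn (\<xi> - x0) * \<bar>\<xi> - x0\<bar> powr \<gamma>)" for D \<xi>
  have "(H D has_real_derivative h D \<xi>) (at \<xi>)" for D \<xi>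
  proof -
    have "((\<lambda>x. \<bar>x - x0\<bar> powr (1 + \<gamma>) / (1 + \<gamma>)) has_real_derivative
        sgn (\<xi> - x0) * \<bar>\<xi> - x0\<bar> powr \<gamma>) (at \<xi>)"
      using has_real_derivative_abs_powr[OF \<open>\<gamma> > 0\<close>, of "\<xi> - x0"]
        DERIV_shift[of "\<lambda>x. \<bar>x\<bar> powr (1 + \<gamma>) / (1 + \<gamma>)" _ \<xi> "- x0"] by simp
    then show ?thesis
      unfolding H_def h_def by (intro DERIV_add DERIV_cmult_Id DERIV_cmult)
  qed
  then have h: "(h D has_integral (H D q - H D p)) {p..q}" if "p \<le> q" for D p q
    using that by (intro fundamental_theorem_of_calculus)
      (auto simp flip: has_real_derivative_iff_has_vector_derivative intro: has_field_derivative_at_within)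
  obtain P where P: "\<And>p q. p \<le> q \<Longrightarrow> (\<phi> has_integral (P q - P p)) {p..q}"
    using ex_indefinite_integral abs_int_phi set_lebesgue_integral_eq_integral(1) by metis
  have Phi: "Phi_fun \<phi> l x0 c = P (x0 + l) - P x0 - c * l" for l
    by (simp add: Phi_fun_eq interval_lebesgue_integral_lebesgue_eq[OF abs_int_phi P])
  have Phi_bounds: "(C - \<epsilon>) * (\<bar>l\<bar> powr (1 + \<gamma>) / (1 + \<gamma>)) \<le> Phi_fun \<phi> l x0 c"
    "Phi_fun \<phi> l x0 c \<le> (C + \<epsilon>) * (\<bar>l\<bar> powr (1 + \<gamma>) / (1 + \<gamma>))" if l: "l \<in> S" "\<bar>l\<bar> < d" for l
  proof -
    show "(C - \<epsilon>) * (\<bar>l\<bar> powr (1 + \<gamma>) / (1 + \<gamma>)) \<le> Phi_fun \<phi> l x0 c"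
    proof (cases "S = {0<..}")
      case True
      have "H (C - \<epsilon>) (x0 + l) - H (C - \<epsilon>) x0 \<le> P (x0 + l) - P x0"
        by (rule has_integral_le_AE[OF h P])
          (use l True bound in \<open>auto simp: h_def algebra_simps elim!: eventually_mono\<close>)
      then show ?thesis by (simp add: Phi H_def algebra_simps)
    next
      case False
      \<comment> \<open>On the left \<open>sgn\<close> is -1, so lowering the coefficient to
        \<open>C - \<epsilon>\<close> raises the comparison function; the orientation of the
        integral reverses the inequality once more.\<close>
      have "P x0 - P (x0 + l) \<le> H (C - \<epsilon>) x0 - H (C - \<epsilon>) (x0 + l)"
        by (rule has_integral_le_AE[OF P h])
          (use l S False bound in \<open>auto simp: h_def algebra_simps elim!: eventually_mono\<close>)
      then show ?thesis by (simp add: Phi H_def algebra_simps)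
    qed
    show "Phi_fun \<phi> l x0 c \<le> (C + \<epsilon>) * (\<bar>l\<bar> powr (1 + \<gamma>) / (1 + \<gamma>))"
    proof (cases "S = {0<..}")
      case True
      have "P (x0 + l) - P x0 \<le> H (C + \<epsilon>) (x0 + l) - H (C + \<epsilon>) x0"
        by (rule has_integral_le_AE[OF P h])
          (use l True bound in \<open>auto simp: h_def algebra_simps elim!: eventually_mono\<close>)
      then show ?thesis by (simp add: Phi H_def algebra_simps)
    next
      case False
      have "H (C + \<epsilon>) x0 - H (C + \<epsilon>) (x0 + l) \<le> P x0 - P (x0 + l)"
        by (rule has_integral_le_AE[OF h P])
          (use l S False bound in \<open>auto simp: h_def algebra_simps elim!: eventually_mono\<close>)
      then show ?thesis by (simp add: Phi H_def algebra_simps)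
    qed
  qed
  have "dist (\<bar>l\<bar> powr (- (1 + \<gamma>)) * Phi_fun \<phi> l x0 c) (C / (1 + \<gamma>)) < e" if l: "l \<in> S" "\<bar>l\<bar> < d" for l
  proof -
    define Y where "Y = \<bar>l\<bar> powr (1 + \<gamma>)"
    have "Y > 0" using l S by (auto simp: Y_def)
    have "(C - \<epsilon>) / (1 + \<gamma>) * Y \<le> Phi_fun \<phi> l x0 c" "Phi_fun \<phi> l x0 c \<le> (C + \<epsilon>) / (1 + \<gamma>) * Y"
      using Phi_bounds[OF l] by (simp_all add: Y_def)
    then have "(C - \<epsilon>) / (1 + \<gamma>) \<le> Phi_fun \<phi> l x0 c / Y" "Phi_fun \<phi> l x0 c / Y \<le> (C + \<epsilon>) / (1 + \<gamma>)"
      using \<open>Y > 0\<close> by (simp_all only: pos_le_divide_eq pos_divide_le_eq)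
    moreover have "\<epsilon> / (1 + \<gamma>) = e / 2"
      using \<open>\<gamma> > 0\<close> by (simp add: \<epsilon>_def field_simps)
    ultimately have "\<bar>Phi_fun \<phi> l x0 c / Y - C / (1 + \<gamma>)\<bar> \<le> e / 2"
      unfolding diff_divide_distrib add_divide_distrib by linarith
    moreover have "\<bar>l\<bar> powr (- (1 + \<gamma>)) * Phi_fun \<phi> l x0 c = Phi_fun \<phi> l x0 c / Y"
      unfolding Y_def powr_minus by (simp add: divide_inverse mult.commute)
    ultimately show ?thesis
      using \<open>e > 0\<close> by (simp add: dist_real_def)
  qed
  then show "\<forall>\<^sub>F l in at 0 within S. dist (\<bar>l\<bar> powr (- (1 + \<gamma>)) * Phi_fun \<phi> l x0 c) (C / (1 + \<gamma>)) < e"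
    using \<open>d > 0\<close> by (auto simp: eventually_at dist_real_def)
qed

text \<open>\<open>\<Phi>\<close> has order 1 + \<gamma>, and (2+\<alpha>)/(1+\<alpha>) = 1 +
  1/(1+\<alpha>), so comparing the two exponents means comparing \<gamma> with
  1/(1+\<alpha>).\<close>

lemma Liminf_gt_iff:
  assumes "ae_sgn_power_asymp (\<lambda>l. \<phi> (x0 + l) - c) C \<gamma> S"
    and "\<gamma> > 0" "C \<noteq> 0" "\<alpha> \<ge> 0" and S: "S = {..<0} \<or> S = {0<..}"
  shows "Liminf (at 0 within S) (\<lambda>l. ereal (\<bar>l\<bar> powr (- ((2 + \<alpha>) / (1 + \<alpha>))) * Phi_fun \<phi> l x0 c)) > - \<infinity>
    \<longleftrightarrow> C > 0 \<or> \<gamma> * (1 + \<alpha>) \<ge> 1"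
proof -
  have "C / (1 + \<gamma>) \<noteq> 0" "C / (1 + \<gamma>) > 0 \<longleftrightarrow> C > 0"
    using assms by (auto simp: zero_less_divide_iff)
  moreover have "at 0 within S \<noteq> bot" using S by auto
  moreover have "(2 + \<alpha>) / (1 + \<alpha>) \<le> 1 + \<gamma> \<longleftrightarrow> \<gamma> * (1 + \<alpha>) \<ge> 1"
    using assms by (simp add: field_simps)
  ultimately show ?thesis
    using powr_tendsto_imp_Liminf_gt_iff[OF Phi_fun_asymp[OF assms(1,2) S]] by metis
qed

end

section \<open>Assembly of the three cases\<close>

theorem theorem3p8:
  fixes f f' f'' \<phi> :: "real \<Rightarrow> real" and x0 a b :: real
  assumes f': "\<And>u. (f has_real_derivative f' u) (at u)"
    and f'': "\<And>u. (f' has_real_derivative f'' u) (at u)"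
    and f''_cont: "continuous_on UNIV f''"
    and f''_nonneg: "\<And>u. f'' u \<ge> 0"
    and f''_null: "{u. f'' u = 0} \<in> null_sets lebesgue"
    and phi_meas: "\<phi> \<in> borel_measurable lebesgue"
    and phi_bdd: "\<exists>M. AE x in lebesgue. \<bar>\<phi> x\<bar> \<le> M"
    and a: "a = real_of_ereal (upper_left_dini \<phi> x0)"
    and b: "b = real_of_ereal (lower_right_dini \<phi> x0)"
  shows
    "(a > b \<longrightarrow> gen_values f' f'' \<phi> x0 = {})
     \<and>
     (a < b \<longrightarrow>
        {a<..<b} \<subseteq> gen_values f' f'' \<phi> x0 \<and> gen_values f' f'' \<phi> x0 \<subseteq> {a..b}
        \<and>
        (a \<in> gen_values f' f'' \<phi> x0 \<longleftrightarrow>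
           (\<exists>t1>0. \<forall>\<^sub>F l in at_left 0. Phi_fun \<phi> l x0 a > F_fun f' f'' l t1 a))
        \<and>
        (b \<in> gen_values f' f'' \<phi> x0 \<longleftrightarrow>
           (\<exists>t2>0. \<forall>\<^sub>F l in at_right 0. Phi_fun \<phi> l x0 b > F_fun f' f'' l t2 b))
        \<and>
        (\<forall>\<alpha>p Np. \<alpha>p \<ge> 0 \<and> Np > 0 \<and> power_asymp f'' a Np \<alpha>p (at_right a) \<longrightarrow>
           (a \<in> gen_values f' f'' \<phi> x0 \<longleftrightarrow>
              Liminf (at_left 0)
                (\<lambda>l. ereal (\<bar>l\<bar> powr (- ((2 + \<alpha>p) / (1 + \<alpha>p))) * Phi_fun \<phi> l x0 a)) > - \<infinity>)
           \<and>
           (\<forall>\<gamma>m Cm. \<gamma>m > 0 \<and> Cm \<noteq> 0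
                \<and> ae_sgn_power_asymp (\<lambda>l. \<phi> (x0 + l) - a) Cm \<gamma>m {..<0} \<longrightarrow>
              (a \<in> gen_values f' f'' \<phi> x0 \<longleftrightarrow> Cm > 0 \<or> \<gamma>m * (1 + \<alpha>p) \<ge> 1)))
        \<and>
        (\<forall>\<alpha>m Nm. \<alpha>m \<ge> 0 \<and> Nm > 0 \<and> power_asymp f'' b Nm \<alpha>m (at_left b) \<longrightarrow>
           (b \<in> gen_values f' f'' \<phi> x0 \<longleftrightarrow>
              Liminf (at_right 0)
                (\<lambda>l. ereal (\<bar>l\<bar> powr (- ((2 + \<alpha>m) / (1 + \<alpha>m))) * Phi_fun \<phi> l x0 b)) > - \<infinity>)
           \<and>
           (\<forall>\<gamma>p Cp. \<gamma>p > 0 \<and> Cp \<noteq> 0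
                \<and> ae_sgn_power_asymp (\<lambda>l. \<phi> (x0 + l) - b) Cp \<gamma>p {0<..} \<longrightarrow>
              (b \<in> gen_values f' f'' \<phi> x0 \<longleftrightarrow> Cp > 0 \<or> \<gamma>p * (1 + \<alpha>m) \<ge> 1))))
     \<and>
     (a = b \<longrightarrow>
        (gen_values f' f'' \<phi> x0 = {a} \<or> gen_values f' f'' \<phi> x0 = {})
        \<and>
        (a \<in> gen_values f' f'' \<phi> x0 \<longleftrightarrow>
           (\<exists>t1>0. \<forall>\<^sub>F l in at 0. Phi_fun \<phi> l x0 a > F_fun f' f'' l t1 a))
        \<and>
        (\<forall>\<alpha>p Np \<alpha>m Nm.
           \<alpha>p \<ge> 0 \<and> Np > 0 \<and> power_asymp f'' a Np \<alpha>p (at_right a)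
           \<and> \<alpha>m \<ge> 0 \<and> Nm > 0 \<and> power_asymp f'' a Nm \<alpha>m (at_left a) \<longrightarrow>
           (gen_values f' f'' \<phi> x0 = {} \<longleftrightarrow>
              Liminf (at_right 0)
                (\<lambda>l. ereal (\<bar>l\<bar> powr (- ((2 + \<alpha>m) / (1 + \<alpha>m))) * Phi_fun \<phi> l x0 a)) = - \<infinity>
              \<or>
              Liminf (at_left 0)
                (\<lambda>l. ereal (\<bar>l\<bar> powr (- ((2 + \<alpha>p) / (1 + \<alpha>p))) * Phi_fun \<phi> l x0 a)) = - \<infinity>)
           \<and>
           (\<forall>\<gamma>p Cp \<gamma>m Cm.
              \<gamma>p > 0 \<and> Cp \<noteq> 0 \<and> ae_sgn_power_asymp (\<lambda>l. \<phi> (x0 + l) - a) Cp \<gamma>p {0<..}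
              \<and> \<gamma>m > 0 \<and> Cm \<noteq> 0 \<and> ae_sgn_power_asymp (\<lambda>l. \<phi> (x0 + l) - a) Cm \<gamma>m {..<0} \<longrightarrow>
              (gen_values f' f'' \<phi> x0 = {} \<longleftrightarrow>
                 (Cp < 0 \<and> \<gamma>p * (1 + \<alpha>m) < 1) \<or> (Cm < 0 \<and> \<gamma>m * (1 + \<alpha>p) < 1)))))"
proof -
  obtain M where M: "AE x in lebesgue. \<bar>\<phi> x\<bar> \<le> M"
    using phi_bdd by blast
  interpret entropy_setting f f' f'' \<phi> x0 M
    by unfold_locales (use assms M strict_mono_if_deriv_pos_AE[OF f'' f''_nonneg f''_null] in auto)
  define L where "L c \<longleftrightarrow> (\<exists>t>0. \<forall>\<^sub>F l in at_left 0. F_fun f' f'' l t c < Phi_fun \<phi> l x0 c)" for c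
  define R where "R c \<longleftrightarrow> (\<exists>t>0. \<forall>\<^sub>F l in at_right 0. F_fun f' f'' l t c < Phi_fun \<phi> l x0 c)" for c
  have gen: "c \<in> gen_values f' f'' \<phi> x0 \<longleftrightarrow> L c \<and> R c" for c
    unfolding L_def R_def by (rule gen_values_iff_sides)
  have ab: "upper_left_dini \<phi> x0 = ereal a" "lower_right_dini \<phi> x0 = ereal b"
    using dini_finite[OF phi_meas M, of x0] unfolding a b by (simp_all add: ereal_real)
  \<comment> \<open>Thus \<open>L\<close> holds on a half-line to the right of \<open>a\<close> and
    \<open>R\<close> on one to the left of \<open>b\<close>, each with or without its end point.
    Only the end points remain to be decided.\<close>
  have LR: "a < c \<Longrightarrow> L c" "L c \<Longrightarrow> a \<le> c" "c < b \<Longrightarrow> R c" "R c \<Longrightarrow> c \<le> b" for c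
    using left_if_greater[of c] left_imp_ge[of _ c] right_if_less[of c] right_imp_le[of _ c]
    by (auto simp: L_def R_def ab)
  note L_Liminf = left_iff_Liminf[folded L_def] and R_Liminf = right_iff_Liminf[folded R_def]
  have L_asymp: "L c \<longleftrightarrow> C > 0 \<or> \<gamma> * (1 + \<alpha>) \<ge> 1"
    if "\<alpha> \<ge> 0 \<and> N > 0 \<and> power_asymp f'' c N \<alpha> (at_right c)"
      "\<gamma> > 0 \<and> C \<noteq> 0 \<and> ae_sgn_power_asymp (\<lambda>l. \<phi> (x0 + l) - c) C \<gamma> {..<0}" for c \<alpha> N \<gamma> C
    using that L_Liminf[of \<alpha> N c] Liminf_gt_iff[of c C \<gamma> "{..<0}" \<alpha>] by simp
  have R_asymp: "R c \<longleftrightarrow> C > 0 \<or> \<gamma> * (1 + \<alpha>) \<ge> 1"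
    if "\<alpha> \<ge> 0 \<and> N > 0 \<and> power_asymp f'' c N \<alpha> (at_left c)"
      "\<gamma> > 0 \<and> C \<noteq> 0 \<and> ae_sgn_power_asymp (\<lambda>l. \<phi> (x0 + l) - c) C \<gamma> {0<..}" for c \<alpha> N \<gamma> C
    using that R_Liminf[of \<alpha> N c] Liminf_gt_iff[of c C \<gamma> "{0<..}" \<alpha>] by simp
  show ?thesis
  proof (intro conjI impI allI)
    show "gen_values f' f'' \<phi> x0 = {}" if "b < a"
      using that LR by (force simp: gen)
  next
    assume "a < b"
    \<comment> \<open>Since \<open>a < b\<close>, the condition on the other side holds strictly at
      each end point, so one side decides.\<close>
    then have a_iff: "a \<in> gen_values f' f'' \<phi> x0 \<longleftrightarrow> L a" and b_iff: "b \<in> gen_values f' f'' \<phi> x0 \<longleftrightarrow> R b"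
      using LR by (auto simp: gen)
    show "{a<..<b} \<subseteq> gen_values f' f'' \<phi> x0" "gen_values f' f'' \<phi> x0 \<subseteq> {a..b}"
      using LR by (auto simp: gen)
    show "a \<in> gen_values f' f'' \<phi> x0 \<longleftrightarrow>
        (\<exists>t1>0. \<forall>\<^sub>F l in at_left 0. F_fun f' f'' l t1 a < Phi_fun \<phi> l x0 a)"
      by (simp only: a_iff L_def)
    show "b \<in> gen_values f' f'' \<phi> x0 \<longleftrightarrow>
        (\<exists>t2>0. \<forall>\<^sub>F l in at_right 0. F_fun f' f'' l t2 b < Phi_fun \<phi> l x0 b)"
      by (simp only: b_iff R_def)
    {
      fix \<alpha> N assume *: "0 \<le> \<alpha> \<and> 0 < N \<and> power_asymp f'' a N \<alpha> (at_right a)"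
      show "a \<in> gen_values f' f'' \<phi> x0 \<longleftrightarrow> - \<infinity> < Liminf (at_left 0)
          (\<lambda>l. ereal (\<bar>l\<bar> powr - ((2 + \<alpha>) / (1 + \<alpha>)) * Phi_fun \<phi> l x0 a))"
        using * L_Liminf[of \<alpha> N a] a_iff by simp
      fix \<gamma> C assume "0 < \<gamma> \<and> C \<noteq> 0 \<and> ae_sgn_power_asymp (\<lambda>l. \<phi> (x0 + l) - a) C \<gamma> {..<0}"
      then show "a \<in> gen_values f' f'' \<phi> x0 \<longleftrightarrow> 0 < C \<or> 1 \<le> \<gamma> * (1 + \<alpha>)"
        using L_asymp[OF *] a_iff by blast
    }
    {
      fix \<alpha> N assume *: "0 \<le> \<alpha> \<and> 0 < N \<and> power_asymp f'' b N \<alpha> (at_left b)"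
      show "b \<in> gen_values f' f'' \<phi> x0 \<longleftrightarrow> - \<infinity> < Liminf (at_right 0)
          (\<lambda>l. ereal (\<bar>l\<bar> powr - ((2 + \<alpha>) / (1 + \<alpha>)) * Phi_fun \<phi> l x0 b))"
        using * R_Liminf[of \<alpha> N b] b_iff by simp
      fix \<gamma> C assume "0 < \<gamma> \<and> C \<noteq> 0 \<and> ae_sgn_power_asymp (\<lambda>l. \<phi> (x0 + l) - b) C \<gamma> {0<..}"
      then show "b \<in> gen_values f' f'' \<phi> x0 \<longleftrightarrow> 0 < C \<or> 1 \<le> \<gamma> * (1 + \<alpha>)"
        using R_asymp[OF *] b_iff by blast
    }
  next
    assume "a = b"
    then have sub: "gen_values f' f'' \<phi> x0 \<subseteq> {a}"
      using LR by (force simp: gen)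
    then show "gen_values f' f'' \<phi> x0 = {a} \<or> gen_values f' f'' \<phi> x0 = {}"
      by blast
    \<comment> \<open>Here \<open>a\<close> is the only candidate and is an end point for both
      sides, so the failure of either condition empties the set.\<close>
    have empty_iff: "gen_values f' f'' \<phi> x0 = {} \<longleftrightarrow> \<not> R a \<or> \<not> L a"
      using sub gen by blast
    show "a \<in> gen_values f' f'' \<phi> x0 \<longleftrightarrow>
        (\<exists>t1>0. \<forall>\<^sub>F l in at 0. F_fun f' f'' l t1 a < Phi_fun \<phi> l x0 a)"
      by (rule gen_values_iff_eventually)
    fix \<alpha>p Np \<alpha>m Nm
    assume *: "0 \<le> \<alpha>p \<and> 0 < Np \<and> power_asymp f'' a Np \<alpha>p (at_right a) \<and>
      0 \<le> \<alpha>m \<and> 0 < Nm \<and> power_asymp f'' a Nm \<alpha>m (at_left a)"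
    show "gen_values f' f'' \<phi> x0 = {} \<longleftrightarrow>
        Liminf (at_right 0) (\<lambda>l. ereal (\<bar>l\<bar> powr - ((2 + \<alpha>m) / (1 + \<alpha>m)) * Phi_fun \<phi> l x0 a)) = - \<infinity> \<or>
        Liminf (at_left 0) (\<lambda>l. ereal (\<bar>l\<bar> powr - ((2 + \<alpha>p) / (1 + \<alpha>p)) * Phi_fun \<phi> l x0 a)) = - \<infinity>"
      using * L_Liminf[of \<alpha>p Np a] R_Liminf[of \<alpha>m Nm a] by (simp add: empty_iff)
    fix \<gamma>p Cp \<gamma>m Cm
    assume "0 < \<gamma>p \<and> Cp \<noteq> 0 \<and> ae_sgn_power_asymp (\<lambda>l. \<phi> (x0 + l) - a) Cp \<gamma>p {0<..} \<and>
      0 < \<gamma>m \<and> Cm \<noteq> 0 \<and> ae_sgn_power_asymp (\<lambda>l. \<phi> (x0 + l) - a) Cm \<gamma>m {..<0}"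
    with * have "R a \<longleftrightarrow> 0 < Cp \<or> 1 \<le> \<gamma>p * (1 + \<alpha>m)" "L a \<longleftrightarrow> 0 < Cm \<or> 1 \<le> \<gamma>m * (1 + \<alpha>p)"
      "Cp \<noteq> 0" "Cm \<noteq> 0"
      using L_asymp[of \<alpha>p Np a \<gamma>m Cm] R_asymp[of \<alpha>m Nm a \<gamma>p Cp] by blast+
    then show "gen_values f' f'' \<phi> x0 = {} \<longleftrightarrow>
        Cp < 0 \<and> \<gamma>p * (1 + \<alpha>m) < 1 \<or> Cm < 0 \<and> \<gamma>m * (1 + \<alpha>p) < 1"
      unfolding empty_iff by (auto simp: not_less not_le)
  qed
qed

end
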